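(* For $m=1$, the bounds $\text{m-CYCLE}\le(1+2m)\,\text{TSP-mD}$ (valid for all instances) and $\text{m-CYCLE}\le(1+m)\,\text{TSP-mD}$ (valid for all instances in which every feasible sortie is a loop or contains only one customer) are asymptotically tight; that is, for every $\delta>0$ there is an instance with $m=1$ and $\frac{\text{m-CYCLE}}{\text{TSP-mD}}\ge 3-\delta$, and there is an instance with $m=1$, in which every feasible sortie is a loop or contains only one customer, with $\frac{\text{m-CYCLE}}{\text{TSP-mD}}\ge 2-\delta$. Moreover, for every $m$, there exists an instance with $m$ drones for which $\frac{\text{m-CYCLE}}{\text{TSP-mD}}\ge m$.
   Context: Instance. An instance of the TSP-mD (Traveling Salesman Problem with Drones) consists of a finite set $N$ of nodes with a depot $0\in N$; the complete directed graph with arc set $A=\{(i,j)\in N\times N: i\neq j\}$; subsets $N^{tr},N^{dr}\subseteq N$ (nodes that can be served by the truck, resp. by the drones) with $N^{tr}\cup N^{dr}=N$ and $0\in N^{tr}$; two metrics $\ell,\ell'$ on $N$ ($\ell_{ij}$, resp. $\ell'_{ij}$, is the time the truck, resp. a drone, needs to traverse $(i,j)$); a number $m\ge 1$ of identical drones; a drone weight $w^{dr}>0$; payloads $w_i\ge 0$ for $i\in N^{dr}$; and a battery capacity $B>0$. Sorties. A sortie is a tuple $\pi=(i_1,\dots,i_r)$, $r\ge 3$, with $i_1,i_r\in N^{tr}$, $i_2,\dots,i_{r-1}\in N^{dr}$ and consecutive nodes distinct. It is a loop if $i_1=i_r$. It serves the nodes $N[\pi]=\{i_2,\dots,i_{r-1}\}$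 and has duration $\ell'_\pi=\sum_{q=1}^{r-1}\ell'_{i_qi_{q+1}}$. Its energy consumption is $w^{dr}\sum_{q=1}^{r-1}\ell'_{i_qi_{q+1}}+\sum_{p=2}^{r-1}\bigl(w_{i_p}\sum_{q=1}^{p-1}\ell'_{i_qi_{q+1}}\bigr)$, and it is feasible if this is at most $B$. Solutions. A (feasible) solution consists of a truck route, which is a closed walk $0=v_0,v_1,\dots,v_n=0$ with all $v_t\in N^{tr}$ and consecutive nodes distinct (nodes and arcs may be repeated), and a finite family of feasible sorties, each assigned to a drone and to a pair of visit indices $s\le e$ such that the sortie starts at $v_s$ (launch from the truck at its visit number $s$) and ends at $v_e$ (retrieval by the truck at visit number $e$). The sorties of the same drone are performed one after the other (each one is launched at or after the visit at which the previous one was retrieved, and after that retrieval). Every node of $N$ must be on the truck route or served by some sortie. The truck starts at time $0$; it may wait at nodes, a drone may wait at its landing node for the truck, a sortie with duration $\ell'_\pi$ launched while the truck is at visit $s$ lands $\ell'_\pi$ time units after launch, and the truck may not leave visit $e$ before the drone has landed. Launching, retrieving, serving and battery swapping take no time. The completion time is the earliest time at which the truck has completed its route and all drones have been retrieved at the depot or earlier; it is to be minimized over all solutions. Only instances admitting at least one feasible solution are considered. For an instance, TSP-mD also denotes the minimum completion time over all solutions, and m-CYCLE denotes the minimum completion time over all solutions whose truck route does not revisit nodes (i.e. $v_0,\dots,v_{n-1}$ are pairwise distinct; the depot occurs only as start and end). *)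

theory Defs
  imports "HOL-Analysis.Abstract_Metric_Spaces"
begin

text \<open>Nodes are natural numbers and the depot is the node \<open>0\<close>.\<close>

record tsp_instance =
  nodes :: "nat set"
  truck_nodes :: "nat set"
  drone_nodes :: "nat set"
  truck_time :: "nat \<Rightarrow> nat \<Rightarrow> real"
  drone_time :: "nat \<Rightarrow> nat \<Rightarrow> real"
  num_drones :: nat
  drone_weight :: real
  payload :: "nat \<Rightarrow> real"
  battery :: real

definition tsp_mD_instance :: "tsp_instance \<Rightarrow> bool" where
  "tsp_mD_instance I \<longleftrightarrow>
     finite (nodes I) \<and>
     truck_nodes I \<union> drone_nodes I = nodes I \<and>
     0 \<in> truck_nodes I \<and>
     Metric_space (nodes I) (truck_time I) \<and>
     Metric_space (nodes I) (drone_time I) \<and>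
     num_drones I \<ge> 1 \<and>
     drone_weight I > 0 \<and>
     (\<forall>i\<in>drone_nodes I. payload I i \<ge> 0) \<and>
     battery I > 0"


subsection \<open>Sorties\<close>

text \<open>A tuple \<open>(i\<^sub>1, \<dots>, i\<^sub>r)\<close> is a list, so its entry \<open>i\<^sub>q\<close> is \<open>\<pi> ! (q - 1)\<close> and
  \<open>(i\<^sub>2, \<dots>, i\<^sub>r\<^sub>-\<^sub>1)\<close> is \<open>butlast (tl \<pi>)\<close>.\<close>

definition served :: "nat list \<Rightarrow> nat set" where
  "served \<pi> = set (butlast (tl \<pi>))"

definition sortie :: "tsp_instance \<Rightarrow> nat list \<Rightarrow> bool" where
  "sortie I \<pi> \<longleftrightarrow>
     length \<pi> \<ge> 3 \<and> hd \<pi> \<in> truck_nodes I \<and> last \<pi> \<in> truck_nodes I \<and>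
     served \<pi> \<subseteq> drone_nodes I \<and> distinct_adj \<pi>"

definition is_loop :: "nat list \<Rightarrow> bool" where
  "is_loop \<pi> \<longleftrightarrow> hd \<pi> = last \<pi>"

definition duration :: "tsp_instance \<Rightarrow> nat list \<Rightarrow> real" where
  "duration I \<pi> = (\<Sum>q<length \<pi> - 1. drone_time I (\<pi> ! q) (\<pi> ! Suc q))"

definition energy :: "tsp_instance \<Rightarrow> nat list \<Rightarrow> real" where
  "energy I \<pi> = drone_weight I * duration I \<pi> +
     (\<Sum>p\<in>{1..<length \<pi> - 1}.
        payload I (\<pi> ! p) * (\<Sum>q<p. drone_time I (\<pi> ! q) (\<pi> ! Suc q)))"

definition feasible_sortie :: "tsp_instance \<Rightarrow> nat list \<Rightarrow> bool" where
  "feasible_sortie I \<pi> \<longleftrightarrow> sortie I \<pi> \<and> energy I \<pi> \<le> battery I"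


subsection \<open>Solutions\<close>

text \<open>A mission is a sortie together with the truck visits (indices into the truck route) of its
  launch and its retrieval. The \<open>j\<close>-th entry of \<open>missions S\<close> lists the missions of drone \<open>j\<close> in
  the order in which they are performed.\<close>

record mission =
  sortie_of :: "nat list"
  launch_visit :: nat
  retrieval_visit :: nat

record plan =
  route :: "nat list"
  missions :: "mission list list"

definition truck_route :: "tsp_instance \<Rightarrow> nat list \<Rightarrow> bool" where
  "truck_route I vs \<longleftrightarrow>
     vs \<noteq> [] \<and> hd vs = 0 \<and> last vs = 0 \<and> set vs \<subseteq> truck_nodes I \<and> distinct_adj vs"

definition feasible_mission :: "tsp_instance \<Rightarrow> nat list \<Rightarrow> mission \<Rightarrow> bool" where
  "feasible_mission I vs x \<longleftrightarrow>
     feasible_sortie I (sortie_of x) \<and>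
     launch_visit x \<le> retrieval_visit x \<and> retrieval_visit x < length vs \<and>
     hd (sortie_of x) = vs ! launch_visit x \<and> last (sortie_of x) = vs ! retrieval_visit x"

definition solution :: "tsp_instance \<Rightarrow> plan \<Rightarrow> bool" where
  "solution I S \<longleftrightarrow>
     truck_route I (route S) \<and>
     length (missions S) = num_drones I \<and>
     (\<forall>xs\<in>set (missions S). \<forall>x\<in>set xs. feasible_mission I (route S) x) \<and>
     (\<forall>xs\<in>set (missions S). \<forall>k. Suc k < length xs \<longrightarrow>
        retrieval_visit (xs ! k) \<le> launch_visit (xs ! Suc k)) \<and>
     nodes I \<subseteq> set (route S) \<union> (\<Union>xs\<in>set (missions S). \<Union>x\<in>set xs. served (sortie_of x))"

definition cycle_solution :: "tsp_instance \<Rightarrow> plan \<Rightarrow> bool" where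
  "cycle_solution I S \<longleftrightarrow> solution I S \<and> distinct (butlast (route S))"


subsection \<open>Timing\<close>

text \<open>The truck is present at visit \<open>t\<close> during \<open>{arr t..dep t}\<close>. The \<open>k\<close>-th sortie of drone \<open>j\<close> is
  launched from the truck at time \<open>lau j k\<close> and is back on the truck at time \<open>ret j k\<close>; the
  difference may exceed its duration, because the drone may wait at its landing node.
  In particular \<open>dep t\<close> is not before the landing of any sortie retrieved at visit \<open>t\<close>.\<close>

definition schedule ::
  "tsp_instance \<Rightarrow> plan \<Rightarrow> (nat \<Rightarrow> real) \<Rightarrow> (nat \<Rightarrow> real) \<Rightarrow>
   (nat \<Rightarrow> nat \<Rightarrow> real) \<Rightarrow> (nat \<Rightarrow> nat \<Rightarrow> real) \<Rightarrow> bool" where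
  "schedule I S arr dep lau ret \<longleftrightarrow>
     arr 0 = 0 \<and>
     (\<forall>t<length (route S). arr t \<le> dep t) \<and>
     (\<forall>t. Suc t < length (route S) \<longrightarrow>
        arr (Suc t) = dep t + truck_time I (route S ! t) (route S ! Suc t)) \<and>
     (\<forall>j<length (missions S). \<forall>k<length (missions S ! j).
        let x = missions S ! j ! k in
          arr (launch_visit x) \<le> lau j k \<and> lau j k \<le> dep (launch_visit x) \<and>
          lau j k + duration I (sortie_of x) \<le> ret j k \<and>
          arr (retrieval_visit x) \<le> ret j k \<and> ret j k \<le> dep (retrieval_visit x)) \<and>
     (\<forall>j<length (missions S). \<forall>k. Suc k < length (missions S ! j) \<longrightarrow>
        ret j k \<le> lau j (Suc k))"

text \<open>The truck has completed its route and all drones have been retrieved at the time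
  \<open>dep n\<close>, where \<open>n = length (route S) - 1\<close> is the last visit. This visit
  has no successor, so \<open>dep n\<close> is bounded below only by \<open>arr n\<close> and the retrievals at visit \<open>n\<close>.\<close>

definition completion_time :: "tsp_instance \<Rightarrow> plan \<Rightarrow> real" where
  "completion_time I S =
     (LEAST T. \<exists>arr dep lau ret.
        schedule I S arr dep lau ret \<and> T = dep (length (route S) - 1))"

definition TSP_mD :: "tsp_instance \<Rightarrow> real" where
  "TSP_mD I = (LEAST T. \<exists>S. solution I S \<and> T = completion_time I S)"

definition m_CYCLE :: "tsp_instance \<Rightarrow> real" where
  "m_CYCLE I = (LEAST T. \<exists>S. cycle_solution I S \<and> T = completion_time I S)"

definition loops_or_single_customer :: "tsp_instance \<Rightarrow> bool" where
  "loops_or_single_customer I \<longleftrightarrow>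
     (\<forall>\<pi>. feasible_sortie I \<pi> \<longrightarrow> is_loop \<pi> \<or> card (served \<pi>) = 1)"

end

theory Submission
  imports Defs
begin

text \<open>If all traversal times are integers, rounding down every time of a schedule gives a schedule.
  So all completion times are natural numbers and the minima are attained.

  For many drones, take \<open>m\<close> hubs pairwise at distance \<open>1\<close>, a leaf that only the truck can serve
  at distance about \<open>t\<close>, and for each hub a customer that a drone can only serve by a loop of
  duration \<open>2 t\<close> at this hub. With revisits, all loops are flown in parallel while the truck drives to
  the leaf and back, in time about \<open>2 t\<close>. On a cycle each loop blocks the truck at its hub, and the
  completion time is at least \<open>2 t (m + 1)\<close>.

  For the ratio \<open>3\<close>, take two hubs \<open>a\<close> and \<open>b\<close>, and \<open>n\<close> groups of a truck-only leaf and two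
  adjacent customers \<open>x\<close>, \<open>y\<close>, all at distance about \<open>t\<close> from the hubs. With revisits, in each of \<open>n\<close>
  rounds the truck drives from \<open>a\<close> via a leaf to \<open>b\<close> while the drone flies \<open>(a, x, y, b)\<close>, in time
  about \<open>2 n t\<close> in total. On a cycle at most one sortie can join \<open>a\<close> and \<open>b\<close>, so all but two of the
  \<open>2 n\<close> customers need loops of duration \<open>2 t\<close> for which the truck waits, in addition to its
  driving time of at least \<open>2 n t\<close>.\<close>

subsection \<open>Attainment of the minima\<close>

text \<open>\<open>LEAST\<close> on the reals is informative only if a minimum exists. Here every
  witness has a natural witness below it, and the naturals are well-ordered.\<close>

lemma Least_real_attained:
  fixes P :: "real \<Rightarrow> bool"
  assumes ex: "P y" and nat: "\<And>x. P x \<Longrightarrow> \<exists>n::nat. real n \<le> x \<and> P (real n)"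
  shows "\<exists>n::nat. (LEAST x. P x) = real n" "P (LEAST x. P x)" "\<And>x. P x \<Longrightarrow> (LEAST x. P x) \<le> x"
proof -
  define n where "n = (LEAST n::nat. P (real n))"
  have P: "P (real n)"
    unfolding n_def using nat[OF ex] by (metis LeastI)
  have le: "real n \<le> x" if "P x" for x
    using nat[OF that] unfolding n_def by (metis Least_le of_nat_le_iff order_trans)
  have "(LEAST x. P x) = real n"
    by (rule Least_equality) (fact P, fact le)
  then show "\<exists>n::nat. (LEAST x. P x) = real n" "P (LEAST x. P x)" "\<And>x. P x \<Longrightarrow> (LEAST x. P x) \<le> x"
    using P le by auto
qed

text \<open>Telescoping the recursion for \<open>arr\<close> separates the waiting of the truck from
  its driving; the lower bounds estimate the two sums independently.\<close>

lemma schedule_dep: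
  assumes "schedule I S arr dep lau ret" and "t < length (route S)"
  shows "dep t = (\<Sum>i\<le>t. dep i - arr i) + (\<Sum>i<t. truck_time I (route S ! i) (route S ! Suc i))"
  using assms(2)
proof (induction t)
  case 0
  then show ?case using assms(1) by (simp add: schedule_def)
next
  case (Suc t)
  then have "arr (Suc t) = dep t + truck_time I (route S ! t) (route S ! Suc t)"
    using assms(1) by (simp add: schedule_def)
  with Suc show ?case by simp
qed

section \<open>Schedules under integral traversal times\<close>

locale integral_instance =
  fixes I :: tsp_instance
  assumes inst: "tsp_mD_instance I"
    and truck_Ints: "truck_time I u v \<in> \<int>"
    and drone_Ints: "drone_time I u v \<in> \<int>"
begin

lemma truck_nonneg: "0 \<le> truck_time I u v"
  using inst by (auto simp: tsp_mD_instance_def Metric_space.nonneg)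

lemma drone_nonneg: "0 \<le> drone_time I u v"
  using inst by (auto simp: tsp_mD_instance_def Metric_space.nonneg)

lemma duration_nonneg: "0 \<le> duration I \<pi>"
  unfolding duration_def by (intro sum_nonneg drone_nonneg)

lemma duration_Ints: "duration I \<pi> \<in> \<int>"
  unfolding duration_def by (intro Ints_sum drone_Ints)

lemma schedule_nonneg:
  assumes "schedule I S arr dep lau ret" and "t < length (route S)"
  shows "0 \<le> dep t"
proof -
  have "0 \<le> (\<Sum>i\<le>t. dep i - arr i)"
    using assms by (intro sum_nonneg) (auto simp: schedule_def)
  moreover have "0 \<le> (\<Sum>i<t. truck_time I (route S ! i) (route S ! Suc i))"
    by (intro sum_nonneg truck_nonneg)
  ultimately show ?thesis using schedule_dep[OF assms] by linarith
qed

lemma mission_visits: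
  assumes "solution I S" "j < length (missions S)" "k < length (missions S ! j)"
  shows "launch_visit (missions S ! j ! k) \<le> retrieval_visit (missions S ! j ! k)"
    and "retrieval_visit (missions S ! j ! k) < length (route S)"
proof -
  have "feasible_mission I (route S) (missions S ! j ! k)"
    using assms unfolding solution_def by (meson nth_mem)
  then show "launch_visit (missions S ! j ! k) \<le> retrieval_visit (missions S ! j ! k)"
      and "retrieval_visit (missions S ! j ! k) < length (route S)"
    by (auto simp: feasible_mission_def)
qed

lemma mission_order:
  assumes "solution I S" "j < length (missions S)" "Suc k < length (missions S ! j)"
  shows "retrieval_visit (missions S ! j ! k) \<le> launch_visit (missions S ! j ! Suc k)"
  using assms by (auto simp: solution_def)

text \<open>A wasteful schedule always works. The sum \<open>D\<close> of all durations bounds each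
  single flight, and at every visit the truck waits for as many slots of length \<open>D\<close> as
  there are missions. The \<open>k\<close>-th mission of a drone starts with slot \<open>k\<close>
  of its launch visit and is back at the end of slot \<open>k\<close> of its retrieval
  visit.\<close>

lemma schedule_exists:
  assumes S: "solution I S"
  shows "\<exists>arr dep lau ret. schedule I S arr dep lau ret"
proof -
  let ?K = "\<Sum>xs\<leftarrow>missions S. length xs"
  define D where "D = (\<Sum>xs\<leftarrow>missions S. \<Sum>x\<leftarrow>xs. duration I (sortie_of x))"
  have K: "length (missions S ! j) \<le> ?K" if "j < length (missions S)" for j
    using that by (intro member_le_sum_list) auto
  have D: "duration I (sortie_of (missions S ! j ! k)) \<le> D"
    if "j < length (missions S)" "k < length (missions S ! j)" for j k
  proof -
    have "duration I (sortie_of (missions S ! j ! k)) \<le>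
        (\<Sum>x\<leftarrow>missions S ! j. duration I (sortie_of x))"
      using that by (intro member_le_sum_list) (auto simp: duration_nonneg)
    also have "\<dots> \<le> D"
      unfolding D_def using that
      by (intro member_le_sum_list) (auto intro!: sum_list_nonneg duration_nonneg)
    finally show ?thesis .
  qed
  have D0: "0 \<le> D"
    unfolding D_def by (auto intro!: sum_list_nonneg duration_nonneg)
  define M where "M = real ?K * D"
  have M0: "0 \<le> M" using D0 by (simp add: M_def)
  define arr where
    "arr t = (\<Sum>i<t. M + truck_time I (route S ! i) (route S ! Suc i))" for t
  define dep where "dep t = arr t + M" for t
  define lau where "lau j k = arr (launch_visit (missions S ! j ! k)) + real k * D" for j k
  define ret where "ret j k = arr (retrieval_visit (missions S ! j ! k)) + real (Suc k) * D" for j k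
  have arr_mono: "arr s \<le> arr e" if "s \<le> e" for s e
    unfolding arr_def using that by (intro sum_mono2) (auto simp: M0 truck_nonneg)
  have kM: "real (Suc k) * D \<le> M" if "j < length (missions S)" "k < length (missions S ! j)" for j k
    unfolding M_def using K[OF that(1)] that(2) D0 by (intro mult_right_mono) auto
  have "schedule I S arr dep lau ret"
    unfolding schedule_def Let_def
  proof (intro conjI allI impI)
    fix j k assume jk: "j < length (missions S)" "k < length (missions S ! j)"
    let ?x = "missions S ! j ! k"
    have kD: "0 \<le> real k * D" using D0 by simp
    show "arr (launch_visit ?x) \<le> lau j k"
      using kD by (simp add: lau_def)
    show "lau j k \<le> dep (launch_visit ?x)"
      using kM[OF jk] D0 by (simp add: lau_def dep_def algebra_simps)
    show "lau j k + duration I (sortie_of ?x) \<le> ret j k"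
      using arr_mono[OF mission_visits(1)[OF S jk]] D[OF jk]
      by (simp add: lau_def ret_def algebra_simps)
    show "arr (retrieval_visit ?x) \<le> ret j k"
      using kD D0 by (simp add: ret_def algebra_simps)
    show "ret j k \<le> dep (retrieval_visit ?x)"
      using kM[OF jk] by (simp add: ret_def dep_def)
  next
    fix j k assume jk: "j < length (missions S)" "Suc k < length (missions S ! j)"
    show "ret j k \<le> lau j (Suc k)"
      using arr_mono[OF mission_order[OF S jk]] by (simp add: lau_def ret_def)
  qed (auto simp: arr_def dep_def M0)
  then show ?thesis by blast
qed

text \<open>Rounding down is monotone and commutes with adding integers, so every equation and
  inequality of a schedule survives.\<close>

lemma schedule_floor:
  assumes "schedule I S arr dep lau ret"
  shows "schedule I S (\<lambda>t. of_int \<lfloor>arr t\<rfloor>) (\<lambda>t. of_int \<lfloor>dep t\<rfloor>)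
           (\<lambda>j k. of_int \<lfloor>lau j k\<rfloor>) (\<lambda>j k. of_int \<lfloor>ret j k\<rfloor>)"
proof -
  have fl: "of_int \<lfloor>x + z\<rfloor> = of_int \<lfloor>x\<rfloor> + z" if "z \<in> \<int>" for x z :: real
    using that by (elim Ints_cases) simp
  have add: "of_int \<lfloor>x\<rfloor> + duration I \<pi> \<le> of_int \<lfloor>y\<rfloor>" if "x + duration I \<pi> \<le> y" for x y :: real and \<pi>
    using floor_mono[OF that] fl[OF duration_Ints[of \<pi>], of x] by linarith
  show ?thesis
    using assms unfolding schedule_def Let_def
    by (auto simp: fl[OF truck_Ints] intro!: floor_mono add)
qed

text \<open>The last departure is nonnegative, so rounding a schedule down yields a natural number;
  this is the descent that \<open>Least_real_attained\<close> asks for.\<close>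

lemma completion_time:
  assumes S: "solution I S"
  shows "\<exists>n::nat. completion_time I S = real n"
    and "\<exists>arr dep lau ret. schedule I S arr dep lau ret \<and>
           completion_time I S = dep (length (route S) - 1)"
    and "\<And>arr dep lau ret. schedule I S arr dep lau ret \<Longrightarrow>
           completion_time I S \<le> dep (length (route S) - 1)"
proof -
  let ?P = "\<lambda>T. \<exists>arr dep lau ret. schedule I S arr dep lau ret \<and> T = dep (length (route S) - 1)"
  obtain T where T: "?P T"
    using schedule_exists[OF S] by blast
  have len: "length (route S) - 1 < length (route S)"
    using S by (simp add: solution_def truck_route_def)
  have nat: "\<exists>n::nat. real n \<le> T \<and> ?P (real n)" if "?P T" for T
  proof -
    from that obtain arr dep lau ret
      where sch: "schedule I S arr dep lau ret" and T: "T = dep (length (route S) - 1)"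
      by blast
    have "real (nat \<lfloor>T\<rfloor>) = of_int \<lfloor>T\<rfloor>"
      using schedule_nonneg[OF sch len] T by simp
    moreover have "?P (of_int \<lfloor>T\<rfloor>)"
      using schedule_floor[OF sch] T by blast
    ultimately show ?thesis
      by (intro exI[of _ "nat \<lfloor>T\<rfloor>"]) simp
  qed
  note least = Least_real_attained[of ?P, OF T nat, folded completion_time_def]
  show "\<exists>n::nat. completion_time I S = real n" by (rule least(1))
  show "\<exists>arr dep lau ret. schedule I S arr dep lau ret \<and>
           completion_time I S = dep (length (route S) - 1)" by (rule least(2))
  show "completion_time I S \<le> dep (length (route S) - 1)"
    if "schedule I S arr dep lau ret" for arr dep lau ret
    using least(3) that by blast
qed

text \<open>\<open>Q\<close> is a parameter in order to cover both \<open>TSP_mD\<close> and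
  \<open>m_CYCLE\<close>. The descent is trivial here, since completion times are natural numbers
  already.\<close>

lemma optimum_attained:
  assumes sol: "\<And>S. Q S \<Longrightarrow> solution I S" and S: "Q S"
  shows "\<exists>S. Q S \<and> (LEAST T. \<exists>S. Q S \<and> T = completion_time I S) = completion_time I S"
    and "(LEAST T. \<exists>S. Q S \<and> T = completion_time I S) \<le> completion_time I S"
proof -
  let ?P = "\<lambda>T. \<exists>S. Q S \<and> T = completion_time I S"
  have ex: "?P (completion_time I S)"
    using S by blast
  have "\<exists>n::nat. real n \<le> T \<and> ?P (real n)" if "?P T" for T
    using that completion_time(1)[OF sol] by (metis order_refl)
  note least = Least_real_attained[of ?P, OF ex this]
  show "\<exists>S. Q S \<and> (LEAST T. ?P T) = completion_time I S" by (rule least(2))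
  show "(LEAST T. ?P T) \<le> completion_time I S" using least(3) ex by blast
qed

text \<open>The optimum is attained by a plan and its completion time by a schedule, so a bound on
  all schedules passes to the optimum.\<close>

lemma optimum_ge:
  assumes sol: "\<And>S. Q S \<Longrightarrow> solution I S" and S: "Q S"
    and ge: "\<And>S arr dep lau ret. Q S \<Longrightarrow> schedule I S arr dep lau ret \<Longrightarrow>
           c \<le> dep (length (route S) - 1)"
  shows "c \<le> (LEAST T. \<exists>S. Q S \<and> T = completion_time I S)"
proof -
  obtain S' where S': "Q S'" and eq: "(LEAST T. \<exists>S. Q S \<and> T = completion_time I S) = completion_time I S'"
    using optimum_attained(1)[of Q, OF sol S] by blast
  obtain arr dep lau ret where "schedule I S' arr dep lau ret"
      "completion_time I S' = dep (length (route S') - 1)"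
    using completion_time(2)[OF sol[OF S']] by blast
  then show ?thesis
    using ge[OF S'] eq by simp
qed

text \<open>In the schedule without any waiting of the truck, each drone has exactly the driving
  time between its launch and retrieval visits for its flight; \<open>fast\<close> says that this
  suffices.\<close>

lemma TSP_mD_le_travel:
  assumes S: "solution I S"
    and fast: "\<And>x xs. xs \<in> set (missions S) \<Longrightarrow> x \<in> set xs \<Longrightarrow> duration I (sortie_of x) \<le>
           (\<Sum>i\<in>{launch_visit x..<retrieval_visit x}. truck_time I (route S ! i) (route S ! Suc i))"
  shows "TSP_mD I \<le> (\<Sum>i<length (route S) - 1. truck_time I (route S ! i) (route S ! Suc i))"
proof -
  define arr where "arr t = (\<Sum>i<t. truck_time I (route S ! i) (route S ! Suc i))" for t
  have arr_mono: "arr s \<le> arr e" if "s \<le> e" for s e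
    unfolding arr_def using that by (intro sum_mono2) (auto simp: truck_nonneg)
  have arr_add: "arr e = arr s + (\<Sum>i\<in>{s..<e}. truck_time I (route S ! i) (route S ! Suc i))"
    if "s \<le> e" for s e
    unfolding arr_def using that
    by (simp add: lessThan_atLeast0 sum.atLeastLessThan_concat)
  have "schedule I S arr arr (\<lambda>j k. arr (launch_visit (missions S ! j ! k)))
      (\<lambda>j k. arr (retrieval_visit (missions S ! j ! k)))"
    unfolding schedule_def Let_def
  proof (intro conjI allI impI)
    fix j k assume jk: "j < length (missions S)" "k < length (missions S ! j)"
    show "arr (launch_visit (missions S ! j ! k)) + duration I (sortie_of (missions S ! j ! k))
        \<le> arr (retrieval_visit (missions S ! j ! k))"
      using arr_add[OF mission_visits(1)[OF S jk]] fast[of "missions S ! j" "missions S ! j ! k"] jk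
      by simp
  next
    fix j k assume "j < length (missions S)" "Suc k < length (missions S ! j)"
    then show "arr (retrieval_visit (missions S ! j ! k)) \<le> arr (launch_visit (missions S ! j ! Suc k))"
      by (intro arr_mono mission_order[OF S])
  qed (simp_all add: arr_def)
  then have "completion_time I S \<le> arr (length (route S) - 1)"
    by (rule completion_time(3)[OF S])
  then show ?thesis
    using optimum_attained(2)[of "solution I", OF _ S] by (simp add: TSP_mD_def arr_def)
qed

lemma duration_triangle:
  assumes "set \<pi> \<subseteq> nodes I" "p \<le> q" "q < length \<pi>"
  shows "drone_time I (\<pi> ! p) (\<pi> ! q) \<le> (\<Sum>i\<in>{p..<q}. drone_time I (\<pi> ! i) (\<pi> ! Suc i))"
proof -
  have *: "Metric_space (nodes I) (drone_time I)"
    using inst by (simp add: tsp_mD_instance_def)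
  show ?thesis
    using assms(2,3)
proof (induction q rule: dec_induct)
  case base
  then have "\<pi> ! p \<in> nodes I"
    using assms(1) by auto
  then show ?case
    using Metric_space.mdist_zero[OF *] by simp
next
  case (step q)
  have "{\<pi> ! p, \<pi> ! q, \<pi> ! Suc q} \<subseteq> nodes I"
    using assms(1) step by auto
  then show ?case
    using step Metric_space.triangle[OF *, of "\<pi> ! p" "\<pi> ! q" "\<pi> ! Suc q"] by simp
qed
qed

end


subsection \<open>Star metrics\<close>

text \<open>The metric of a weighted star whose centre is not a node: the leg of \<open>u\<close>
  has length \<open>h u + 1/2\<close>. The halves keep distinct nodes apart where \<open>h\<close>
  vanishes.\<close>

definition star :: "(nat \<Rightarrow> real) \<Rightarrow> nat \<Rightarrow> nat \<Rightarrow> real" where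
  "star h u v = (if u = v then 0 else h u + h v + 1)"

lemma Metric_space_star:
  assumes "\<And>u. 0 \<le> h u"
  shows "Metric_space M (star h)"
proof
  fix u v w
  show "0 \<le> star h u v"
    using assms[of u] assms[of v] by (simp add: star_def)
  show "star h u v = star h v u"
    by (simp add: star_def)
  show "star h u v = 0 \<longleftrightarrow> u = v"
    using assms[of u] assms[of v] by (simp add: star_def)
  show "star h u w \<le> star h u v + star h v w"
    using assms[of u] assms[of v] assms[of w] by (simp add: star_def)
qed

lemma star_Ints:
  assumes "\<And>u. h u \<in> \<int>"
  shows "star h u v \<in> \<int>"
  using assms by (auto simp: star_def)

text \<open>Every visit pays \<open>h\<close> once on entering and once on leaving, except at the
  two ends of the walk; every arc pays \<open>1\<close> in addition.\<close>

lemma star_travel: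
  assumes "vs \<noteq> []" "distinct_adj vs"
  shows "(\<Sum>i<length vs - 1. star h (vs ! i) (vs ! Suc i)) =
    2 * (\<Sum>v\<leftarrow>vs. h v) - h (hd vs) - h (last vs) + real (length vs - 1)"
  using assms
proof (induction vs rule: induct_list012)
  case (3 u v vs)
  let ?d = "\<lambda>vs i. star h (vs ! i) (vs ! Suc i)"
  have "(\<Sum>i<length (u # v # vs) - 1. ?d (u # v # vs) i) =
      star h u v + (\<Sum>i<length (v # vs) - 1. ?d (v # vs) i)"
    by (simp add: sum.lessThan_Suc_shift del: sum.lessThan_Suc)
  also have "star h u v = h u + h v + 1"
    using 3 by (simp add: star_def)
  also note "3.IH"(2)
  finally show ?case
    using 3 by simp
qed auto

lemma sum_set_le_sum_list:
  fixes h :: "'a \<Rightarrow> real"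
  assumes "\<And>u. 0 \<le> h u"
  shows "(\<Sum>v\<in>set vs. h v) \<le> (\<Sum>v\<leftarrow>vs. h v)"
proof (induction vs)
  case (Cons v vs)
  then show ?case
    using assms[of v] by (cases "v \<in> set vs") (auto simp: insert_absorb)
qed simp


subsection \<open>Bounds on completion times\<close>

text \<open>Induction removes the interval with the largest index and replaces \<open>b\<close> by
  its left end, before which all others have ended.\<close>

lemma disjoint_intervals_sum_le:
  fixes l r d :: "nat \<Rightarrow> real"
  assumes "finite K" "a \<le> b"
    and "\<And>k. k \<in> K \<Longrightarrow> a \<le> l k \<and> l k + d k \<le> r k \<and> r k \<le> b"
    and "\<And>k k'. k \<in> K \<Longrightarrow> k' \<in> K \<Longrightarrow> k < k' \<Longrightarrow> r k \<le> l k'"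
  shows "sum d K \<le> b - a"
  using assms
proof (induction K arbitrary: b rule: finite_linorder_max_induct)
  case (insert k K)
  have "sum d K \<le> l k - a"
    using insert.hyps insert.prems by (intro insert.IH) auto
  moreover have "l k + d k \<le> b"
    using insert.prems(2)[of k] by auto
  moreover have "k \<notin> K"
    using insert.hyps by blast
  ultimately show ?case
    using insert.hyps by simp
qed simp

lemma served_nth:
  assumes "c \<in> served \<pi>"
  obtains p where "0 < p" "Suc p < length \<pi>" "\<pi> ! p = c"
proof -
  obtain i where "i < length (butlast (tl \<pi>))" "butlast (tl \<pi>) ! i = c"
    using assms by (metis in_set_conv_nth served_def)
  then show ?thesis
    using that[of "Suc i"] by (auto simp: nth_butlast nth_tl)
qed

lemma set_sortie:
  assumes "length \<pi> \<ge> 3"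
  shows "set \<pi> = {hd \<pi>, last \<pi>} \<union> served \<pi>"
proof -
  obtain u \<rho> where "\<pi> = u # \<rho>" "\<rho> \<noteq> []"
    using assms by (cases \<pi>; cases "tl \<pi>") auto
  moreover from this have "set \<rho> = insert (last \<rho>) (set (butlast \<rho>))"
    by (metis Un_insert_right append_butlast_last_id empty_set list.simps(15) set_append sup_bot_right)
  ultimately show ?thesis
    by (auto simp: served_def)
qed

section \<open>Flight durations, waiting times and driving times\<close>

context integral_instance
begin

lemma sortie_nodes:
  assumes "sortie I \<pi>"
  shows "set \<pi> \<subseteq> nodes I"
  using assms inst set_sortie[of \<pi>] by (auto simp: sortie_def tsp_mD_instance_def)

lemma duration_split:
  assumes "p \<le> q" "q < length \<pi>"
  shows "duration I \<pi> = (\<Sum>i\<in>{0..<p}. drone_time I (\<pi> ! i) (\<pi> ! Suc i)) +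
    (\<Sum>i\<in>{p..<q}. drone_time I (\<pi> ! i) (\<pi> ! Suc i)) +
    (\<Sum>i\<in>{q..<length \<pi> - 1}. drone_time I (\<pi> ! i) (\<pi> ! Suc i))"
  using assms by (simp add: duration_def sum.atLeastLessThan_concat lessThan_atLeast0)

text \<open>The sortie is cut at the positions \<open>p\<close> and \<open>q\<close>, and the
  iterated triangle inequality is applied to each of the three pieces.\<close>

lemma duration_ge_via:
  assumes "sortie I \<pi>" "p \<le> q" "q < length \<pi>"
  shows "drone_time I (hd \<pi>) (\<pi> ! p) + drone_time I (\<pi> ! p) (\<pi> ! q) +
    drone_time I (\<pi> ! q) (last \<pi>) \<le> duration I \<pi>"
proof -
  note nodes = sortie_nodes[OF assms(1)]
  have "\<pi> \<noteq> []" using assms by auto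
  moreover have "drone_time I (\<pi> ! 0) (\<pi> ! p) \<le> (\<Sum>i\<in>{0..<p}. drone_time I (\<pi> ! i) (\<pi> ! Suc i))"
    using assms by (intro duration_triangle[OF nodes]) auto
  moreover have "drone_time I (\<pi> ! p) (\<pi> ! q) \<le> (\<Sum>i\<in>{p..<q}. drone_time I (\<pi> ! i) (\<pi> ! Suc i))"
    using assms by (intro duration_triangle[OF nodes]) auto
  moreover have "drone_time I (\<pi> ! q) (\<pi> ! (length \<pi> - 1)) \<le>
      (\<Sum>i\<in>{q..<length \<pi> - 1}. drone_time I (\<pi> ! i) (\<pi> ! Suc i))"
    using assms by (intro duration_triangle[OF nodes]) auto
  ultimately show ?thesis
    unfolding duration_split[OF assms(2,3)] by (simp add: hd_conv_nth last_conv_nth)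
qed

lemma duration_ge_served:
  assumes "sortie I \<pi>" "c \<in> served \<pi>"
  shows "drone_time I (hd \<pi>) c + drone_time I c (last \<pi>) \<le> duration I \<pi>"
proof -
  obtain p where "0 < p" "Suc p < length \<pi>" "\<pi> ! p = c"
    using served_nth[OF assms(2)] .
  then show ?thesis
    using duration_ge_via[OF assms(1), of p p] drone_nonneg[of c c] by simp
qed

text \<open>The disjunction reflects that either customer may be served first.\<close>

lemma duration_ge_served2:
  assumes "sortie I \<pi>" "c \<in> served \<pi>" "c' \<in> served \<pi>"
  shows "drone_time I (hd \<pi>) c + drone_time I c c' + drone_time I c' (last \<pi>) \<le> duration I \<pi> \<or>
    drone_time I (hd \<pi>) c' + drone_time I c' c + drone_time I c (last \<pi>) \<le> duration I \<pi>"
proof -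
  obtain p where p: "0 < p" "Suc p < length \<pi>" "\<pi> ! p = c"
    using served_nth[OF assms(2)] .
  obtain q where q: "0 < q" "Suc q < length \<pi>" "\<pi> ! q = c'"
    using served_nth[OF assms(3)] .
  show ?thesis
    using duration_ge_via[OF assms(1), of p q] duration_ge_via[OF assms(1), of q p] p q
    by (cases "p \<le> q") auto
qed

text \<open>\<open>schedule\<close> relates only consecutive sorties of a drone; nonnegative
  durations chain these relations.\<close>

lemma missions_sequential:
  assumes sch: "schedule I S arr dep lau ret" and j: "j < length (missions S)"
    and k: "k < k'" "k' < length (missions S ! j)"
  shows "ret j k \<le> lau j k'"
  using k
proof (induction k')
  case (Suc k')
  have step: "ret j k' \<le> lau j (Suc k')"
    using sch j Suc.prems by (simp add: schedule_def)
  have "lau j k' + duration I (sortie_of (missions S ! j ! k')) \<le> ret j k'"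
    using sch j Suc.prems by (simp add: schedule_def Let_def)
  then have "lau j k' \<le> ret j k'"
    using duration_nonneg[of "sortie_of (missions S ! j ! k')"] by linarith
  with step Suc show ?case
    by (cases "k = k'") auto
qed simp

text \<open>The flights of one drone are disjoint in time, and those launched and retrieved at visit
  \<open>v\<close> all lie within the stay of the truck there.\<close>

lemma loop_durations_le_wait:
  assumes sch: "schedule I S arr dep lau ret" and j: "j < length (missions S)"
    and v: "v < length (route S)"
    and K: "\<And>k. k \<in> K \<Longrightarrow> k < length (missions S ! j) \<and>
      launch_visit (missions S ! j ! k) = v \<and> retrieval_visit (missions S ! j ! k) = v"
  shows "(\<Sum>k\<in>K. duration I (sortie_of (missions S ! j ! k))) \<le> dep v - arr v"
proof (rule disjoint_intervals_sum_le)
  have "K \<subseteq> {..<length (missions S ! j)}"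
    using K by auto
  then show "finite K"
    using finite_subset by blast
  show "arr v \<le> dep v"
    using sch v by (simp add: schedule_def)
  show "arr v \<le> lau j k \<and>
      lau j k + duration I (sortie_of (missions S ! j ! k)) \<le> ret j k \<and> ret j k \<le> dep v"
    if "k \<in> K" for k
    using sch j K[OF that] unfolding schedule_def Let_def by metis
  show "ret j k \<le> lau j k'" if "k \<in> K" "k' \<in> K" "k < k'" for k k'
    using missions_sequential[OF sch j that(3)] K[OF that(2)] by blast
qed

lemma truck_only_visited:
  assumes "solution I S" "v \<in> nodes I - drone_nodes I"
  shows "v \<in> set (route S)"
  using assms unfolding solution_def feasible_mission_def feasible_sortie_def sortie_def by blast

lemma drone_only_served:
  assumes "solution I S" "c \<in> nodes I - truck_nodes I"
  obtains j k where "j < length (missions S)" "k < length (missions S ! j)"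
    "c \<in> served (sortie_of (missions S ! j ! k))"
proof -
  have "c \<notin> set (route S)"
    using assms by (auto simp: solution_def truck_route_def)
  then obtain xs x where "xs \<in> set (missions S)" "x \<in> set xs" "c \<in> served (sortie_of x)"
    using assms unfolding solution_def by blast
  then show ?thesis
    using that by (metis in_set_conv_nth)
qed

text \<open>The waits at the visits in \<open>V\<close> contribute \<open>W\<close>. The route must
  contain every node that drones cannot serve, and each of them costs \<open>2 * h v\<close> of
  driving, because the two ends of the route have height \<open>0\<close>.\<close>

lemma dep_last_ge:
  assumes S: "solution I S" and sch: "schedule I S arr dep lau ret"
    and V: "V \<subseteq> {..<length (route S)}" and wait: "W \<le> (\<Sum>v\<in>V. dep v - arr v)"
    and star: "truck_time I = star h" and h: "\<And>u. 0 \<le> h u" "h 0 = 0"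
  shows "W + 2 * (\<Sum>v\<in>nodes I - drone_nodes I. h v) \<le> dep (length (route S) - 1)"
proof -
  let ?n = "length (route S) - 1"
  have r: "route S \<noteq> []" "distinct_adj (route S)" "hd (route S) = 0" "last (route S) = 0"
    using S by (auto simp: solution_def truck_route_def)
  have "W \<le> (\<Sum>v\<le>?n. dep v - arr v)"
  proof (rule order_trans[OF wait])
    show "(\<Sum>v\<in>V. dep v - arr v) \<le> (\<Sum>v\<le>?n. dep v - arr v)"
    proof (rule sum_mono2)
      show "V \<subseteq> {..?n}"
        using V by force
      fix v assume "v \<in> {..?n} - V"
      then have "v < length (route S)"
        using r(1) by (cases "route S") auto
      then show "0 \<le> dep v - arr v"
        using sch by (simp add: schedule_def)
    qed simp
  qed
  moreover have "(\<Sum>v\<in>nodes I - drone_nodes I. h v) \<le> (\<Sum>v\<in>set (route S). h v)"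
    using truck_only_visited[OF S] h(1) by (intro sum_mono2) auto
  moreover have "(\<Sum>v\<in>set (route S). h v) \<le> (\<Sum>v\<leftarrow>route S. h v)"
    by (rule sum_set_le_sum_list[OF h(1)])
  moreover have "(\<Sum>i<?n. truck_time I (route S ! i) (route S ! Suc i)) \<ge> 2 * (\<Sum>v\<leftarrow>route S. h v)"
    using star_travel[OF r(1,2), of h] r h by (simp add: star)
  moreover have "dep ?n = (\<Sum>i\<le>?n. dep i - arr i) +
      (\<Sum>i<?n. truck_time I (route S ! i) (route S ! Suc i))"
    using r(1) by (intro schedule_dep[OF sch]) simp
  ultimately show ?thesis
    by linarith
qed

end

lemma butlast_map_upt: "butlast (map f [0..<Suc n]) = map f [0..<n]"
  by simp

lemma in_map_upt:
  assumes "u = f i" "i < n"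
  shows "u \<in> set (map f [0..<n])"
  using assms by auto

text \<open>Only the last visit lies outside \<open>butlast (route S)\<close>, and it is at the
  depot; hence the exclusion of node \<open>0\<close>.\<close>

lemma cycle_visit_unique:
  assumes S: "cycle_solution I S" and "i < length (route S)" "j < length (route S)"
    and "route S ! i = route S ! j" "route S ! i \<noteq> 0"
  shows "i = j"
proof -
  have r: "route S \<noteq> []" "last (route S) = 0" "distinct (butlast (route S))"
    using S by (auto simp: cycle_solution_def solution_def truck_route_def)
  have "k < length (butlast (route S))" if "k < length (route S)" "route S ! k \<noteq> 0" for k
  proof -
    have "k \<noteq> length (route S) - 1"
      using that r by (metis last_conv_nth)
    then show ?thesis using that by simp
  qed
  then have ij: "i < length (butlast (route S))" "j < length (butlast (route S))"
    using assms by metis+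
  then have "butlast (route S) ! i = butlast (route S) ! j"
    using assms(4) by (simp add: nth_butlast)
  then show ?thesis
    using nth_eq_iff_index_eq[OF r(3) ij] by blast
qed


subsection \<open>Loops at many hubs\<close>

text \<open>Node \<open>1\<close> is the leaf, \<open>2 j\<close> with \<open>j \<ge> 1\<close> is a hub and \<open>2 j + 1\<close> is its customer. The battery
  allows exactly two flights within such a pair.\<close>

definition star_instance :: "nat \<Rightarrow> nat \<Rightarrow> tsp_instance" where
  "star_instance m t =
    \<lparr>nodes = {..2 * m + 1},
     truck_nodes = {u. u \<le> 2 * m + 1 \<and> (even u \<or> u = 1)},
     drone_nodes = {u. u \<le> 2 * m + 1 \<and> odd u \<and> u \<noteq> 1},
     truck_time = star (\<lambda>u. if u = 1 then real t else 0),
     drone_time = (\<lambda>u v. if u = v then 0 else if u div 2 = v div 2 then real t else 2 * real t + 1),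
     num_drones = m,
     drone_weight = 1,
     payload = (\<lambda>_. 0),
     battery = 2 * real t\<rparr>"

lemma star_instance_simps [simp]:
  "nodes (star_instance m t) = {..2 * m + 1}"
  "truck_nodes (star_instance m t) = {u. u \<le> 2 * m + 1 \<and> (even u \<or> u = 1)}"
  "drone_nodes (star_instance m t) = {u. u \<le> 2 * m + 1 \<and> odd u \<and> u \<noteq> 1}"
  "truck_time (star_instance m t) = star (\<lambda>u. if u = 1 then real t else 0)"
  "drone_time (star_instance m t) u v =
     (if u = v then 0 else if u div 2 = v div 2 then real t else 2 * real t + 1)"
  "num_drones (star_instance m t) = m"
  "drone_weight (star_instance m t) = 1"
  "payload (star_instance m t) i = 0"
  "battery (star_instance m t) = 2 * real t"
  by (simp_all add: star_instance_def)

lemma integral_star_instance: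
  assumes "m \<ge> 1" "t \<ge> 1"
  shows "integral_instance (star_instance m t)"
proof
  have "Metric_space {..2 * m + 1} (drone_time (star_instance m t))"
    using assms(2) by unfold_locales auto
  moreover have "Metric_space {..2 * m + 1} (truck_time (star_instance m t))"
    unfolding star_instance_simps by (rule Metric_space_star) simp
  ultimately show "tsp_mD_instance (star_instance m t)"
    using assms by (auto simp: tsp_mD_instance_def)
  show "truck_time (star_instance m t) u v \<in> \<int>" for u v
    by (auto intro: star_Ints)
  show "drone_time (star_instance m t) u v \<in> \<int>" for u v
    by simp
qed

text \<open>A flight between different pairs takes \<open>2 t + 1\<close>, more than the battery
  allows. So both ends lie in the pair of \<open>c\<close>, whose only truck node is the hub
  \<open>c - 1\<close>.\<close>

lemma star_sortie:
  assumes "m \<ge> 1" "t \<ge> 1" and \<pi>: "feasible_sortie (star_instance m t) \<pi>" and c: "c \<in> served \<pi>"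
  shows "hd \<pi> = c - 1 \<and> last \<pi> = c - 1 \<and> 2 * real t \<le> duration (star_instance m t) \<pi>"
proof -
  interpret integral_instance "star_instance m t"
    by (rule integral_star_instance) fact+
  \<comment> \<open>With drone weight \<open>1\<close> and payloads \<open>0\<close>, the energy is
    the duration.\<close>
  have s: "sortie (star_instance m t) \<pi>" and le: "duration (star_instance m t) \<pi> \<le> 2 * real t"
    using \<pi> by (auto simp: feasible_sortie_def energy_def)
  have c': "odd c" "c \<noteq> 1" "even (hd \<pi>) \<or> hd \<pi> = 1" "even (last \<pi>) \<or> last \<pi> = 1"
    using s c by (auto simp: sortie_def)
  have via: "drone_time (star_instance m t) (hd \<pi>) c + drone_time (star_instance m t) c (last \<pi>)
      \<le> duration (star_instance m t) \<pi>"
    by (rule duration_ge_served[OF s c])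
  have ne: "hd \<pi> \<noteq> c" "last \<pi> \<noteq> c"
    using c' by auto
  have "hd \<pi> div 2 = c div 2" "c div 2 = last \<pi> div 2"
    using via le ne by (auto split: if_splits)
  \<comment> \<open>The leaf \<open>1\<close> shares its pair with the depot, and this pair contains
    no customer.\<close>
  moreover have "hd \<pi> \<noteq> 1" "last \<pi> \<noteq> 1"
    using calculation c' by (auto elim!: oddE)
  ultimately show ?thesis
    using c' via ne by (auto elim!: oddE evenE)
qed

text \<open>The route is \<open>0, 2, ..., 2 m, 1, 2, ..., 2 m, 0\<close>. The loop at hub
  \<open>2 j\<close> is launched on the first pass over the hubs and retrieved on the second, with
  one drone per hub.\<close>

definition star_plan :: "nat \<Rightarrow> plan" where
  "star_plan m =
    \<lparr>route = map (\<lambda>i. if i = m + 1 then 1 else 2 * (i mod (m + 1))) [0..<2 * m + 3],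
     missions = map (\<lambda>j. [\<lparr>sortie_of = [2 * j, 2 * j + 1, 2 * j],
       launch_visit = j, retrieval_visit = m + 1 + j\<rparr>]) [1..<Suc m]\<rparr>"

text \<open>This plan only witnesses that a cycle solution exists, so that the minimum in
  \<open>m_CYCLE\<close> is attained.\<close>

definition star_cycle_plan :: "nat \<Rightarrow> plan" where
  "star_cycle_plan m =
    \<lparr>route = map (\<lambda>i. if i = m + 1 then 1 else if i = m + 2 then 0 else 2 * i) [0..<m + 3],
     missions = map (\<lambda>j. [\<lparr>sortie_of = [2 * j, 2 * j + 1, 2 * j],
       launch_visit = j, retrieval_visit = j\<rparr>]) [1..<Suc m]\<rparr>"

lemma star_loop:
  assumes "j \<in> {1..m}"
  shows "feasible_sortie (star_instance m t) [2 * j, 2 * j + 1, 2 * j]"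
    and "duration (star_instance m t) [2 * j, 2 * j + 1, 2 * j] = 2 * real t"
proof -
  show dur: "duration (star_instance m t) [2 * j, 2 * j + 1, 2 * j] = 2 * real t"
    by (simp add: duration_def lessThan_nat_numeral lessThan_Suc)
  show "feasible_sortie (star_instance m t) [2 * j, 2 * j + 1, 2 * j]"
    using assms dur by (auto simp: feasible_sortie_def sortie_def served_def energy_def)
qed

lemma solution_star_plan:
  assumes "m \<ge> 1"
  shows "solution (star_instance m t) (star_plan m)"
proof -
  let ?f = "\<lambda>i. if i = m + 1 then 1 else 2 * (i mod (m + 1))"
  let ?vs = "map ?f [0..<2 * m + 3]"
  have trk: "truck_route (star_instance m t) ?vs"
    unfolding truck_route_def
  proof (intro conjI)
    show "hd ?vs = 0" "last ?vs = 0"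
      by (simp_all add: hd_map last_map mod_if)
    show "set ?vs \<subseteq> truck_nodes (star_instance m t)"
    proof -
      have le: "i mod (m + 1) \<le> m" for i
        using mod_less_divisor[of "m + 1" i] by linarith
      have "2 * (i mod (m + 1)) \<le> 2 * m + 1" for i
        by (rule trans_le_add1[OF mult_le_mono2[OF le]])
      then show ?thesis
        by auto
    qed
    show "distinct_adj ?vs"
      using assms by (auto simp: distinct_adj_conv_nth mod_Suc)
  qed simp
  have fm: "feasible_mission (star_instance m t) ?vs
      \<lparr>sortie_of = [2 * j, 2 * j + 1, 2 * j], launch_visit = j, retrieval_visit = m + 1 + j\<rparr>"
    if "j \<in> {1..m}" for j
  proof -
    have "(m + 1 + j) mod (m + 1) = j"
      unfolding mod_add_self1 using that by simp
    then show ?thesis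
      using that star_loop(1)[OF that] by (auto simp: feasible_mission_def)
  qed
  have cov: "u \<in> set ?vs \<or> (\<exists>j\<in>{1..m}. u = 2 * j + 1)" if "u \<le> 2 * m + 1" for u
  proof (cases "even u \<or> u = 1")
    case True
    then have "u = ?f (if u = 1 then m + 1 else u div 2)"
      using that by (auto elim!: evenE)
    then show ?thesis
      using that by (auto simp: image_iff intro!: bexI[of _ "if u = 1 then m + 1 else u div 2"])
  next
    case False
    then show ?thesis
      using that by (auto elim!: oddE)
  qed
  show ?thesis
    unfolding solution_def
  proof (intro conjI)
    show "nodes (star_instance m t) \<subseteq> set (route (star_plan m)) \<union>
        (\<Union>xs\<in>set (missions (star_plan m)). \<Union>x\<in>set xs. served (sortie_of x))"
    proof
      fix u assume "u \<in> nodes (star_instance m t)"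
      then have "u \<in> set ?vs \<or> (\<exists>j\<in>{1..m}. u = 2 * j + 1)"
        using cov by simp
      then show "u \<in> set (route (star_plan m)) \<union>
          (\<Union>xs\<in>set (missions (star_plan m)). \<Union>x\<in>set xs. served (sortie_of x))"
        unfolding star_plan_def plan.simps by (elim disjE bexE) (auto simp: served_def)
    qed
  qed (use trk fm in \<open>auto simp: star_plan_def simp del: upt_Suc\<close>)
qed

lemma cycle_solution_star_cycle_plan:
  assumes "m \<ge> 1"
  shows "cycle_solution (star_instance m t) (star_cycle_plan m)"
proof -
  let ?f = "\<lambda>i. if i = m + 1 then 1 else if i = m + 2 then 0 else 2 * i"
  let ?vs = "map ?f [0..<m + 3]"
  have trk: "truck_route (star_instance m t) ?vs"
    unfolding truck_route_def
  proof (intro conjI)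
    show "hd ?vs = 0" "last ?vs = 0"
      by (simp_all add: hd_map last_map)
    show "set ?vs \<subseteq> truck_nodes (star_instance m t)"
      by auto
    show "distinct_adj ?vs"
      using assms by (auto simp: distinct_adj_conv_nth)
  qed simp
  have fm: "feasible_mission (star_instance m t) ?vs
      \<lparr>sortie_of = [2 * j, 2 * j + 1, 2 * j], launch_visit = j, retrieval_visit = j\<rparr>"
    if "j \<in> {1..m}" for j
    using that star_loop(1)[OF that] by (auto simp: feasible_mission_def)
  have cov: "u \<in> set ?vs \<or> (\<exists>j\<in>{1..m}. u = 2 * j + 1)" if "u \<le> 2 * m + 1" for u
  proof (cases "even u \<or> u = 1")
    case True
    then have "u = ?f (if u = 1 then m + 1 else u div 2)"
      using that by (auto elim!: evenE)
    then show ?thesis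
      using that by (auto simp: image_iff intro!: bexI[of _ "if u = 1 then m + 1 else u div 2"])
  next
    case False
    then show ?thesis
      using that by (auto elim!: oddE)
  qed
  have "solution (star_instance m t) (star_cycle_plan m)"
    unfolding solution_def
  proof (intro conjI)
    show "nodes (star_instance m t) \<subseteq> set (route (star_cycle_plan m)) \<union>
        (\<Union>xs\<in>set (missions (star_cycle_plan m)). \<Union>x\<in>set xs. served (sortie_of x))"
    proof
      fix u assume "u \<in> nodes (star_instance m t)"
      then have "u \<in> set ?vs \<or> (\<exists>j\<in>{1..m}. u = 2 * j + 1)"
        using cov by simp
      then show "u \<in> set (route (star_cycle_plan m)) \<union>
          (\<Union>xs\<in>set (missions (star_cycle_plan m)). \<Union>x\<in>set xs. served (sortie_of x))"
        unfolding star_cycle_plan_def plan.simps by (elim disjE bexE) (auto simp: served_def)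
    qed
  qed (use trk fm in \<open>auto simp: star_cycle_plan_def simp del: upt_Suc\<close>)
  moreover have "distinct (map ?f [0..<m + 2])"
    by (auto simp: distinct_map inj_on_def)
  moreover have "m + 3 = Suc (m + 2)"
    by simp
  then have "butlast ?vs = map ?f [0..<m + 2]"
    by (simp only: butlast_map_upt)
  ultimately show ?thesis
    by (simp add: cycle_solution_def star_cycle_plan_def)
qed

section \<open>Optimal values of the star instance\<close>

lemma TSP_mD_star_le:
  assumes "m \<ge> 1" "t \<ge> 1"
  shows "TSP_mD (star_instance m t) \<le> 2 * real t + 2 * real m + 2"
proof -
  interpret integral_instance "star_instance m t"
    by (rule integral_star_instance) fact+
  let ?h = "\<lambda>u::nat. if u = 1 then real t else 0"
  let ?f = "\<lambda>i. if i = m + 1 then 1 else 2 * (i mod (m + 1))"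
  let ?vs = "map ?f [0..<2 * m + 3]"
  have S: "solution (star_instance m t) (star_plan m)"
    by (rule solution_star_plan) fact
  have r: "route (star_plan m) = ?vs"
    by (simp add: star_plan_def)
  have fast: "2 * real t \<le> (\<Sum>i\<in>{j..<m + 1 + j}. star ?h (?vs ! i) (?vs ! Suc i))"
    if "j \<in> {1..m}" for j
  proof -
    \<comment> \<open>The arcs \<open>m\<close> and \<open>m + 1\<close> lead into and out of the
      leaf, at cost \<open>t + 1\<close> each, and lie between launch and retrieval of every
      loop.\<close>
    have "2 * real t \<le> (\<Sum>i\<in>{m, m + 1}. star ?h (?vs ! i) (?vs ! Suc i))"
      by (simp add: star_def nth_append)
    also have "\<dots> \<le> (\<Sum>i\<in>{j..<m + 1 + j}. star ?h (?vs ! i) (?vs ! Suc i))"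
      using that by (intro sum_mono2) (auto simp: star_def)
    finally show ?thesis .
  qed
  have "TSP_mD (star_instance m t) \<le>
      (\<Sum>i<length (route (star_plan m)) - 1. truck_time (star_instance m t)
        (route (star_plan m) ! i) (route (star_plan m) ! Suc i))"
  proof (rule TSP_mD_le_travel[OF S])
    fix x xs assume "xs \<in> set (missions (star_plan m))" "x \<in> set xs"
    then obtain j where j: "j \<in> {1..m}" and x: "x = \<lparr>sortie_of = [2 * j, 2 * j + 1, 2 * j],
        launch_visit = j, retrieval_visit = m + 1 + j\<rparr>"
      by (auto simp: star_plan_def)
    show "duration (star_instance m t) (sortie_of x) \<le>
      (\<Sum>i\<in>{launch_visit x..<retrieval_visit x}. truck_time (star_instance m t)
        (route (star_plan m) ! i) (route (star_plan m) ! Suc i))"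
      using fast[OF j] unfolding x r by (simp only: star_loop(2)[OF j] mission.simps star_instance_simps)
  qed
  \<comment> \<open>Both ends are the depot, of height \<open>0\<close>, and the route has
    \<open>2 m + 2\<close> arcs.\<close>
  also have "\<dots> = 2 * (\<Sum>v\<leftarrow>?vs. ?h v) + 2 * real m + 2"
    using S star_travel[of ?vs ?h] unfolding solution_def truck_route_def r star_instance_simps
    by (simp del: upt_Suc)
  also have "(\<Sum>v\<leftarrow>?vs. ?h v) = (\<Sum>i\<in>{0..<2 * m + 3}. if i = m + 1 then real t else 0)"
    unfolding map_map comp_def interv_sum_list_conv_sum_set_nat by (rule sum.cong) auto
  also have "\<dots> = real t"
    by (simp add: sum.delta)
  finally show ?thesis by simp
qed

lemma dep_last_star_ge:
  assumes "m \<ge> 1" "t \<ge> 1" and S: "solution (star_instance m t) S"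
    and sch: "schedule (star_instance m t) S arr dep lau ret"
    and V: "V \<subseteq> {..<length (route S)}" and wait: "W \<le> (\<Sum>v\<in>V. dep v - arr v)"
  shows "W + 2 * real t \<le> dep (length (route S) - 1)"
proof -
  interpret integral_instance "star_instance m t"
    by (rule integral_star_instance) fact+
  let ?h = "\<lambda>u::nat. if u = 1 then real t else 0"
  have "W + 2 * (\<Sum>v\<in>nodes (star_instance m t) - drone_nodes (star_instance m t). ?h v)
      \<le> dep (length (route S) - 1)"
    using assms by (intro dep_last_ge[OF S sch V wait]) auto
  moreover have "(\<Sum>v\<in>nodes (star_instance m t) - drone_nodes (star_instance m t). ?h v) = real t"
    by (subst sum.delta) auto
  ultimately show ?thesis by linarith
qed

text \<open>Reaching the leaf and returning costs \<open>2 t\<close> in any solution. Positivity is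
  required of the denominator of the ratio.\<close>

lemma TSP_mD_star_pos:
  assumes "m \<ge> 1" "t \<ge> 1"
  shows "0 < TSP_mD (star_instance m t)"
proof -
  interpret integral_instance "star_instance m t"
    by (rule integral_star_instance) fact+
  have "2 * real t \<le> TSP_mD (star_instance m t)"
    unfolding TSP_mD_def
  proof (rule optimum_ge)
    show "solution (star_instance m t) (star_plan m)"
      by (rule solution_star_plan) fact
    show "2 * real t \<le> dep (length (route S) - 1)"
      if "solution (star_instance m t) S" "schedule (star_instance m t) S arr dep lau ret"
      for S arr dep lau ret
      using dep_last_star_ge[OF assms that, of "{}" 0] by simp
  qed
  then show ?thesis
    using assms by simp
qed

text \<open>The truck waits \<open>2 t\<close> at each of the \<open>m\<close> hubs, and driving to
  the leaf and back costs another \<open>2 t\<close>.\<close>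

lemma m_CYCLE_star_ge:
  assumes "m \<ge> 1" "t \<ge> 1"
  shows "2 * real t * (real m + 1) \<le> m_CYCLE (star_instance m t)"
proof -
  interpret integral_instance "star_instance m t"
    by (rule integral_star_instance) fact+
  show ?thesis
  unfolding m_CYCLE_def
  proof (rule optimum_ge)
    show "solution (star_instance m t) S" if "cycle_solution (star_instance m t) S" for S
      using that by (simp add: cycle_solution_def)
    show "cycle_solution (star_instance m t) (star_cycle_plan m)"
      by (rule cycle_solution_star_cycle_plan) fact
  next
    fix S arr dep lau ret
    assume cyc: "cycle_solution (star_instance m t) S"
      and sch: "schedule (star_instance m t) S arr dep lau ret"
    have S: "solution (star_instance m t) S"
      using cyc by (simp add: cycle_solution_def)
    have "\<exists>v<length (route S). route S ! v = 2 * i \<and> 2 * real t \<le> dep v - arr v"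
      if i: "i \<in> {1..m}" for i
    proof -
      have "2 * i + 1 \<in> nodes (star_instance m t) - truck_nodes (star_instance m t)"
        using i by auto
      then obtain j k where jk: "j < length (missions S)" "k < length (missions S ! j)"
        and c: "2 * i + 1 \<in> served (sortie_of (missions S ! j ! k))"
        by (rule drone_only_served[OF S])
      let ?x = "missions S ! j ! k"
      have x: "feasible_mission (star_instance m t) (route S) ?x"
        using S jk unfolding solution_def by (meson nth_mem)
      then have \<pi>: "hd (sortie_of ?x) = 2 * i" "last (sortie_of ?x) = 2 * i"
          "2 * real t \<le> duration (star_instance m t) (sortie_of ?x)"
        using star_sortie[OF assms _ c] by (auto simp: feasible_mission_def)
      have v: "launch_visit ?x < length (route S)" "route S ! launch_visit ?x = 2 * i"
          "retrieval_visit ?x < length (route S)" "route S ! retrieval_visit ?x = 2 * i"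
        using x \<pi> by (auto simp: feasible_mission_def)
      \<comment> \<open>A hub differs from the depot and therefore occurs only once on a
        cycle.\<close>
      then have eq: "launch_visit ?x = retrieval_visit ?x"
        using i cycle_visit_unique[OF cyc] by simp
      have "2 * real t \<le> dep (launch_visit ?x) - arr (launch_visit ?x)"
        using loop_durations_le_wait[OF sch jk(1) v(1), of "{k}"] jk eq \<pi> by auto
      with v show ?thesis by blast
    qed
    then obtain v where v: "\<And>i. i \<in> {1..m} \<Longrightarrow> v i < length (route S)"
        "\<And>i. i \<in> {1..m} \<Longrightarrow> route S ! v i = 2 * i"
        "\<And>i. i \<in> {1..m} \<Longrightarrow> 2 * real t \<le> dep (v i) - arr (v i)"
      by metis
    \<comment> \<open>Distinct hubs have distinct visits, so the waits add up even if different
      drones fly the loops.\<close>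
    have inj: "inj_on v {1..m}"
      using v(2) by (intro inj_onI) (metis mult_cancel1 zero_neq_numeral)
    have "2 * real t * real m + 2 * real t \<le> dep (length (route S) - 1)"
    proof (rule dep_last_star_ge[OF assms S sch])
      show "v ` {1..m} \<subseteq> {..<length (route S)}"
        using v(1) by auto
      have "(\<Sum>i\<in>{1..m}. 2 * real t) \<le> (\<Sum>i\<in>{1..m}. dep (v i) - arr (v i))"
        by (intro sum_mono v(3))
      then show "2 * real t * real m \<le> (\<Sum>u\<in>v ` {1..m}. dep u - arr u)"
        unfolding sum.reindex[OF inj] comp_def by (simp add: mult.commute)
    qed
    then show "2 * real t * (real m + 1) \<le> dep (length (route S) - 1)"
      by (simp add: algebra_simps)
  qed
qed

text \<open>Every sortie serves at least the customer \<open>\<pi> ! 1\<close>, which determines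
  both of its ends.\<close>

lemma loops_or_single_customer_star_instance:
  assumes "m \<ge> 1" "t \<ge> 1"
  shows "loops_or_single_customer (star_instance m t)"
  unfolding loops_or_single_customer_def
proof (intro allI impI disjI1)
  fix \<pi> assume \<pi>: "feasible_sortie (star_instance m t) \<pi>"
  then have "length \<pi> \<ge> 3"
    by (simp add: feasible_sortie_def sortie_def)
  then have "\<pi> ! 1 \<in> served \<pi>"
    unfolding served_def by (auto simp: in_set_conv_nth nth_butlast nth_tl intro!: exI[of _ 0])
  then show "is_loop \<pi>"
    using star_sortie[OF assms \<pi>] by (auto simp: is_loop_def)
qed

lemma star_ratio:
  assumes "m \<ge> 1" "t \<ge> 1"
  shows "m_CYCLE (star_instance m t) / TSP_mD (star_instance m t) \<ge>
    real t * (real m + 1) / (real t + real m + 1)"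
proof -
  have "real t * (real m + 1) / (real t + real m + 1) =
      2 * real t * (real m + 1) / (2 * real t + 2 * real m + 2)"
    by (simp add: field_simps)
  also have "\<dots> \<le> m_CYCLE (star_instance m t) / TSP_mD (star_instance m t)"
    using TSP_mD_star_le[OF assms] TSP_mD_star_pos[OF assms] m_CYCLE_star_ge[OF assms]
    by (intro frac_le order_trans[OF _ m_CYCLE_star_ge[OF assms]]) auto
  finally show ?thesis .
qed


subsection \<open>Sorties between two hubs\<close>

text \<open>Node \<open>u\<close> belongs to the group \<open>u div 3\<close>. Group \<open>0\<close> consists of the depot and the hubs
  \<open>a = 1\<close> and \<open>b = 2\<close>; each other group \<open>i\<close> consists of the leaf \<open>3 i\<close>, the customer \<open>3 i + 1\<close> on the side
  of \<open>a\<close> and the customer \<open>3 i + 2\<close> on the side of \<open>b\<close>. The drone metric adds the distance of the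
  groups in a star centred at group \<open>0\<close> and the distance of the sides \<open>u mod 3\<close>. Changing the side costs \<open>1\<close>,
  so the battery \<open>2 t + 1\<close> excludes loops that serve both customers of a group, and side \<open>0\<close> is
  out of reach.\<close>

definition tree_dist :: "nat \<Rightarrow> nat \<Rightarrow> nat \<Rightarrow> real" where
  "tree_dist t i j =
    (if i = j then 0 else (if i = 0 then 0 else real t) + (if j = 0 then 0 else real t))"

definition side_dist :: "nat \<Rightarrow> nat \<Rightarrow> nat \<Rightarrow> real" where
  "side_dist t p q = (if p = q then 0 else if p = 0 \<or> q = 0 then 2 * real t + 2 else 1)"

definition shuttle_instance :: "nat \<Rightarrow> nat \<Rightarrow> tsp_instance" where
  "shuttle_instance n t =
    \<lparr>nodes = {..3 * n + 2},
     truck_nodes = {u. u \<le> 3 * n + 2 \<and> (u \<le> 2 \<or> u mod 3 = 0)},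
     drone_nodes = {u. u \<le> 3 * n + 2 \<and> 2 < u \<and> u mod 3 \<noteq> 0},
     truck_time = star (\<lambda>u. if 2 < u \<and> u mod 3 = 0 then real t else 0),
     drone_time = (\<lambda>u v. tree_dist t (u div 3) (v div 3) + side_dist t (u mod 3) (v mod 3)),
     num_drones = 1,
     drone_weight = 1,
     payload = (\<lambda>_. 0),
     battery = 2 * real t + 1\<rparr>"

lemma shuttle_instance_simps [simp]:
  "nodes (shuttle_instance n t) = {..3 * n + 2}"
  "truck_nodes (shuttle_instance n t) = {u. u \<le> 3 * n + 2 \<and> (u \<le> 2 \<or> u mod 3 = 0)}"
  "drone_nodes (shuttle_instance n t) = {u. u \<le> 3 * n + 2 \<and> 2 < u \<and> u mod 3 \<noteq> 0}"
  "truck_time (shuttle_instance n t) = star (\<lambda>u. if 2 < u \<and> u mod 3 = 0 then real t else 0)"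
  "drone_time (shuttle_instance n t) u v =
     tree_dist t (u div 3) (v div 3) + side_dist t (u mod 3) (v mod 3)"
  "num_drones (shuttle_instance n t) = 1"
  "drone_weight (shuttle_instance n t) = 1"
  "payload (shuttle_instance n t) i = 0"
  "battery (shuttle_instance n t) = 2 * real t + 1"
  by (simp_all add: shuttle_instance_def)

text \<open>A sum of a metric on the groups and a metric on the sides, where group and side together
  determine the node.\<close>

lemma Metric_space_shuttle_drone:
  assumes "t \<ge> 1"
  shows "Metric_space M (drone_time (shuttle_instance n t))"
proof
  fix u v w :: nat
  have nonneg: "0 \<le> tree_dist t i j" "0 \<le> side_dist t i j" for i j
    by (simp_all add: tree_dist_def side_dist_def)
  then show "0 \<le> drone_time (shuttle_instance n t) u v"
    by (simp add: add_nonneg_nonneg)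
  show "drone_time (shuttle_instance n t) u v = drone_time (shuttle_instance n t) v u"
    by (simp add: tree_dist_def side_dist_def)
  have "tree_dist t i j = 0 \<longleftrightarrow> i = j" "side_dist t i j = 0 \<longleftrightarrow> i = j" for i j
    using assms by (simp_all add: tree_dist_def side_dist_def)
  moreover have "u = v \<longleftrightarrow> u div 3 = v div 3 \<and> u mod 3 = v mod 3"
    by (metis div_mult_mod_eq)
  ultimately show "drone_time (shuttle_instance n t) u v = 0 \<longleftrightarrow> u = v"
    by (simp add: add_nonneg_eq_0_iff nonneg)
  have "tree_dist t i k \<le> tree_dist t i j + tree_dist t j k"
      "side_dist t i k \<le> side_dist t i j + side_dist t j k" for i j k
    by (simp_all add: tree_dist_def side_dist_def)
  from add_mono[OF this(1)[of "u div 3" "w div 3" "v div 3"] this(2)[of "u mod 3" "w mod 3" "v mod 3"]]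
  show "drone_time (shuttle_instance n t) u w \<le>
      drone_time (shuttle_instance n t) u v + drone_time (shuttle_instance n t) v w"
    by simp
qed

lemma integral_shuttle_instance:
  assumes "t \<ge> 1"
  shows "integral_instance (shuttle_instance n t)"
proof
  have "Metric_space {..3 * n + 2} (truck_time (shuttle_instance n t))"
    unfolding shuttle_instance_simps by (rule Metric_space_star) simp
  then show "tsp_mD_instance (shuttle_instance n t)"
    using Metric_space_shuttle_drone[OF assms] by (auto simp: tsp_mD_instance_def)
  show "truck_time (shuttle_instance n t) u v \<in> \<int>" for u v
    by (auto intro: star_Ints)
  show "drone_time (shuttle_instance n t) u v \<in> \<int>" for u v
    by (simp add: tree_dist_def side_dist_def)
qed

text \<open>Flying from group \<open>0\<close> to a customer and back costs \<open>2 t\<close>, so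
  at most one unit of battery remains, enough for a single change of side. Hence all customers lie
  in one group, and a loop, which would have to change side twice, serves only one.\<close>

lemma shuttle_sortie:
  assumes "t \<ge> 1" and \<pi>: "feasible_sortie (shuttle_instance n t) \<pi>"
  shows "hd \<pi> \<in> {1, 2}" "last \<pi> \<in> {1, 2}" "2 * real t \<le> duration (shuttle_instance n t) \<pi>"
    and "card (served \<pi>) \<le> 2" "is_loop \<pi> \<Longrightarrow> card (served \<pi>) \<le> 1"
proof -
  interpret integral_instance "shuttle_instance n t"
    by (rule integral_shuttle_instance) fact
  let ?d = "drone_time (shuttle_instance n t)"
  have s: "sortie (shuttle_instance n t) \<pi>" and le: "duration (shuttle_instance n t) \<pi> \<le> 2 * real t + 1"
    using \<pi> by (auto simp: feasible_sortie_def energy_def)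
  have ends: "hd \<pi> \<le> 2 \<or> hd \<pi> mod 3 = 0" "last \<pi> \<le> 2 \<or> last \<pi> mod 3 = 0"
    using s by (auto simp: sortie_def)
  have cust: "0 < c div 3" "c mod 3 = 1 \<or> c mod 3 = 2" if "c \<in> served \<pi>" for c
    using that s by (auto simp: sortie_def div_greater_zero_iff)
  obtain c where c: "c \<in> served \<pi>"
  proof
    show "\<pi> ! 1 \<in> served \<pi>"
      using s unfolding served_def sortie_def
      by (auto simp: in_set_conv_nth nth_butlast nth_tl intro!: exI[of _ 0])
  qed
  have td: "tree_dist t i j \<ge> 0" "side_dist t i j \<ge> 0" for i j
    by (simp_all add: tree_dist_def side_dist_def)
  have via: "?d (hd \<pi>) c + ?d c (last \<pi>) \<le> 2 * real t + 1"
    using duration_ge_served[OF s c] le by linarith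
  have sd: "side_dist t 0 q = 2 * real t + 2" "side_dist t q 0 = 2 * real t + 2" if "q = 1 \<or> q = 2" for q
    using that by (auto simp: side_dist_def)
  \<comment> \<open>Depot and leaves have side \<open>0\<close>, at distance at least
    \<open>2 t + 2\<close> from any customer; this excludes all truck nodes except the hubs.\<close>
  have "hd \<pi> mod 3 \<noteq> 0"
  proof
    assume 0: "hd \<pi> mod 3 = 0"
    show False
      using via sd(1)[OF cust(2)[OF c]] td(1)[of "hd \<pi> div 3" "c div 3"]
        td(1)[of "c div 3" "last \<pi> div 3"] td(2)[of "c mod 3" "last \<pi> mod 3"]
      unfolding shuttle_instance_simps 0 by linarith
  qed
  then show hd: "hd \<pi> \<in> {1, 2}"
    using ends by (cases "hd \<pi> = 0") auto
  have "last \<pi> mod 3 \<noteq> 0"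
  proof
    assume 0: "last \<pi> mod 3 = 0"
    show False
      using via sd(2)[OF cust(2)[OF c]] td(1)[of "hd \<pi> div 3" "c div 3"]
        td(1)[of "c div 3" "last \<pi> div 3"] td(2)[of "hd \<pi> mod 3" "c mod 3"]
      unfolding shuttle_instance_simps 0 by linarith
  qed
  then show last: "last \<pi> \<in> {1, 2}"
    using ends by (cases "last \<pi> = 0") auto
  have div0: "hd \<pi> div 3 = 0" "last \<pi> div 3 = 0"
    using hd last by auto
  have far: "tree_dist t 0 (c div 3) = real t" "tree_dist t (c div 3) 0 = real t"
    if "c \<in> served \<pi>" for c
    using cust(1)[OF that] by (simp_all add: tree_dist_def)
  show "2 * real t \<le> duration (shuttle_instance n t) \<pi>"
    using duration_ge_served[OF s c] far[OF c] div0 td(2)[of "hd \<pi> mod 3" "c mod 3"]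
      td(2)[of "c mod 3" "last \<pi> mod 3"] by simp
  \<comment> \<open>Stated for a fixed order of the two customers, since
    \<open>duration_ge_served2\<close> leaves the order open.\<close>
  have two: "c div 3 = c' div 3 \<and> (is_loop \<pi> \<longrightarrow> c = c')"
    if via2: "?d (hd \<pi>) c + ?d c c' + ?d c' (last \<pi>) \<le> 2 * real t + 1"
      and cc: "c \<in> served \<pi>" "c' \<in> served \<pi>" for c c'
  proof
    have eq: "side_dist t (hd \<pi> mod 3) (c mod 3) + tree_dist t (c div 3) (c' div 3) +
        side_dist t (c mod 3) (c' mod 3) + side_dist t (c' mod 3) (last \<pi> mod 3) \<le> 1"
      using via2 far cc div0 by simp
    \<comment> \<open>Two different customer groups are \<open>2 t\<close>, hence at least
      \<open>2\<close>, apart.\<close>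
    then have "tree_dist t (c div 3) (c' div 3) < 2"
      using td(2)[of "hd \<pi> mod 3" "c mod 3"] td(2)[of "c mod 3" "c' mod 3"]
        td(2)[of "c' mod 3" "last \<pi> mod 3"] by linarith
    then show same: "c div 3 = c' div 3"
      using cust(1)[OF cc(1)] cust(1)[OF cc(2)] \<open>t \<ge> 1\<close> by (auto simp: tree_dist_def split: if_splits)
    show "is_loop \<pi> \<longrightarrow> c = c'"
    proof
      assume "is_loop \<pi>"
      \<comment> \<open>A closed walk through both nonzero sides changes side twice, which exceeds
        the one unit left.\<close>
      have path: "side_dist t p q + side_dist t q r + side_dist t r p = 2"
        if "p = 1 \<or> p = 2" "q = 1 \<or> q = 2" "r = 1 \<or> r = 2" "q \<noteq> r" for p q r
        using that by (auto simp: side_dist_def)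
      have "hd \<pi> mod 3 = 1 \<or> hd \<pi> mod 3 = 2" "last \<pi> = hd \<pi>"
        using hd \<open>is_loop \<pi>\<close> by (auto simp: is_loop_def)
      then have "c mod 3 = c' mod 3"
        using eq td(1)[of "c div 3" "c' div 3"] path[OF _ cust(2)[OF cc(1)] cust(2)[OF cc(2)]]
        by fastforce
      then show "c = c'"
        using same by (metis div_mult_mod_eq)
    qed
  qed
  \<comment> \<open>All customers of the sortie are compared with the fixed customer
    \<open>c\<close>.\<close>
  have pair: "c' div 3 = c div 3 \<and> (is_loop \<pi> \<longrightarrow> c' = c)" if "c' \<in> served \<pi>" for c'
    using duration_ge_served2[OF s c that]
  proof
    assume "?d (hd \<pi>) c + ?d c c' + ?d c' (last \<pi>) \<le> duration (shuttle_instance n t) \<pi>"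
    from two[OF order_trans[OF this le] c that] show ?thesis
      by auto
  next
    assume "?d (hd \<pi>) c' + ?d c' c + ?d c (last \<pi>) \<le> duration (shuttle_instance n t) \<pi>"
    from two[OF order_trans[OF this le] that c] show ?thesis .
  qed
  have "served \<pi> \<subseteq> {3 * (c div 3) + 1, 3 * (c div 3) + 2}"
  proof
    fix c' assume c': "c' \<in> served \<pi>"
    have "c' = 3 * (c' div 3) + c' mod 3"
      by simp
    then show "c' \<in> {3 * (c div 3) + 1, 3 * (c div 3) + 2}"
      using pair[OF c'] cust(2)[OF c'] by auto
  qed
  then show "card (served \<pi>) \<le> 2"
    using card_mono[of "{3 * (c div 3) + 1, 3 * (c div 3) + 2}" "served \<pi>"] by simp
  show "card (served \<pi>) \<le> 1" if "is_loop \<pi>"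
  proof -
    have "served \<pi> \<subseteq> {c}"
      using pair that by blast
    then show ?thesis
      using card_mono[of "{c}"] by simp
  qed
qed

text \<open>Round \<open>q\<close> consists of the visits \<open>3 q + 1\<close>,
  \<open>3 q + 2\<close> and \<open>3 q + 3\<close> at hub \<open>1\<close>, leaf
  \<open>3 q + 3\<close> and hub \<open>2\<close>; the drone flies from the first to the last of
  them.\<close>

definition shuttle_plan :: "nat \<Rightarrow> plan" where
  "shuttle_plan n =
    \<lparr>route = map (\<lambda>i. if i = 0 \<or> i = 3 * n + 1 then 0
        else if i mod 3 = 1 then 1 else if i mod 3 = 2 then i + 1 else 2) [0..<3 * n + 2],
     missions = [map (\<lambda>q. \<lparr>sortie_of = [1, 3 * q + 4, 3 * q + 5, 2],
       launch_visit = 3 * q + 1, retrieval_visit = 3 * q + 3\<rparr>) [0..<n]]\<rparr>"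

text \<open>Again only a witness for the existence of cycle solutions: the drone serves all
  customers by loops while the truck waits, first at hub \<open>1\<close> and then at hub
  \<open>2\<close>.\<close>

definition shuttle_cycle_plan :: "nat \<Rightarrow> plan" where
  "shuttle_cycle_plan n =
    \<lparr>route = map (\<lambda>i. if i < 3 then i else if i = n + 3 then 0 else 3 * (i - 2)) [0..<n + 4],
     missions = [map (\<lambda>k. if k < n
       then \<lparr>sortie_of = [1, 3 * k + 4, 1], launch_visit = 1, retrieval_visit = 1\<rparr>
       else \<lparr>sortie_of = [2, 3 * (k - n) + 5, 2], launch_visit = 2, retrieval_visit = 2\<rparr>) [0..<2 * n]]\<rparr>"

lemma mod_div_3:
  fixes q :: nat
  shows "(3 * q + 4) div 3 = q + 1" "(3 * q + 4) mod 3 = 1"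
    "(3 * q + 5) div 3 = q + 1" "(3 * q + 5) mod 3 = 2"
  by presburger+

lemma shuttle_sorties:
  assumes "q < n"
  shows "feasible_sortie (shuttle_instance n t) [1, 3 * q + 4, 3 * q + 5, 2]"
    and "duration (shuttle_instance n t) [1, 3 * q + 4, 3 * q + 5, 2] = 2 * real t + 1"
    and "feasible_sortie (shuttle_instance n t) [1, 3 * q + 4, 1]"
    and "feasible_sortie (shuttle_instance n t) [2, 3 * q + 5, 2]"
proof -
  show dur: "duration (shuttle_instance n t) [1, 3 * q + 4, 3 * q + 5, 2] = 2 * real t + 1"
    by (simp add: duration_def lessThan_nat_numeral lessThan_Suc mod_div_3 tree_dist_def side_dist_def)
  show "feasible_sortie (shuttle_instance n t) [1, 3 * q + 4, 3 * q + 5, 2]"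
    using assms dur by (auto simp: feasible_sortie_def sortie_def served_def energy_def mod_div_3)
  have "duration (shuttle_instance n t) [1, 3 * q + 4, 1] = 2 * real t"
      "duration (shuttle_instance n t) [2, 3 * q + 5, 2] = 2 * real t"
    by (simp_all add: duration_def lessThan_nat_numeral lessThan_Suc mod_div_3 tree_dist_def side_dist_def)
  then show "feasible_sortie (shuttle_instance n t) [1, 3 * q + 4, 1]"
      "feasible_sortie (shuttle_instance n t) [2, 3 * q + 5, 2]"
    using assms by (auto simp: feasible_sortie_def sortie_def served_def energy_def mod_div_3)
qed

lemma shuttle_nodes_cases:
  fixes u n :: nat
  assumes "u \<le> 3 * n + 2"
  obtains "u \<le> 2" | q where "q < n" "u = 3 * q + 3" | q where "q < n" "u = 3 * q + 4"
    | q where "q < n" "u = 3 * q + 5"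
proof (cases "u \<le> 2")
  case False
  define q where "q = u div 3 - 1"
  have "q < n" "u = 3 * q + 3 \<or> u = 3 * q + 4 \<or> u = 3 * q + 5"
    using False assms unfolding q_def by presburger+
  then show ?thesis
    using that by blast
qed (use that in blast)

lemma solution_shuttle_plan:
  assumes "n \<ge> 1"
  shows "solution (shuttle_instance n t) (shuttle_plan n)"
proof -
  let ?f = "\<lambda>i. if i = 0 \<or> i = 3 * n + 1 then 0
    else if i mod 3 = 1 then 1 else if i mod 3 = 2 then i + 1 else (2::nat)"
  let ?vs = "map ?f [0..<3 * n + 2]"
  have trk: "truck_route (shuttle_instance n t) ?vs"
    unfolding truck_route_def
  proof (intro conjI)
    show "hd ?vs = 0" "last ?vs = 0"
      by (simp_all add: hd_map last_map)
    show "set ?vs \<subseteq> truck_nodes (shuttle_instance n t)"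
      by (auto simp: mod_Suc)
    show "distinct_adj ?vs"
      using assms by (auto simp: distinct_adj_conv_nth mod_Suc simp del: upt_Suc)
  qed simp
  have fm: "feasible_mission (shuttle_instance n t) ?vs
      \<lparr>sortie_of = [1, 3 * q + 4, 3 * q + 5, 2], launch_visit = 3 * q + 1, retrieval_visit = 3 * q + 3\<rparr>"
    if "q < n" for q
    using that shuttle_sorties(1)[OF that] by (auto simp: feasible_mission_def mod_Suc simp del: upt_Suc)
  show ?thesis
    unfolding solution_def
  proof (intro conjI)
    show "nodes (shuttle_instance n t) \<subseteq> set (route (shuttle_plan n)) \<union>
        (\<Union>xs\<in>set (missions (shuttle_plan n)). \<Union>x\<in>set xs. served (sortie_of x))"
    proof
      fix u assume "u \<in> nodes (shuttle_instance n t)"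
      then have "u \<le> 3 * n + 2"
        by simp
      then show "u \<in> set (route (shuttle_plan n)) \<union>
          (\<Union>xs\<in>set (missions (shuttle_plan n)). \<Union>x\<in>set xs. served (sortie_of x))"
      proof (cases rule: shuttle_nodes_cases)
        case 1
        \<comment> \<open>Hub \<open>2\<close> first occurs at visit \<open>3\<close>, since visit
          \<open>2\<close> is at a leaf.\<close>
        then have "u = ?f (if u = 2 then 3 else u)" "(if u = 2 then 3 else u) < 3 * n + 2"
          using assms by auto
        then have "u \<in> set ?vs"
          by (intro in_map_upt[where i = "if u = 2 then 3 else u"])
        then show ?thesis
          unfolding shuttle_plan_def plan.simps by (rule UnI1)
      next
        case (2 q)
        then have "u = ?f (3 * q + 2)" "3 * q + 2 < 3 * n + 2"
          by (auto simp: mod_Suc)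
        then have "u \<in> set ?vs"
          by (intro in_map_upt[where i = "3 * q + 2"])
        then show ?thesis
          unfolding shuttle_plan_def plan.simps by (rule UnI1)
      qed (auto simp: shuttle_plan_def served_def)
    qed
  qed (use trk fm in \<open>auto simp: shuttle_plan_def simp del: upt_Suc\<close>)
qed

lemma cycle_solution_shuttle_cycle_plan:
  assumes "n \<ge> 1"
  shows "cycle_solution (shuttle_instance n t) (shuttle_cycle_plan n)"
proof -
  let ?f = "\<lambda>i. if i < 3 then i else if i = n + 3 then 0 else 3 * (i - 2)"
  let ?g = "\<lambda>k. if k < n
       then \<lparr>sortie_of = [1, 3 * k + 4, 1], launch_visit = 1, retrieval_visit = 1\<rparr>
       else \<lparr>sortie_of = [2, 3 * (k - n) + 5, 2], launch_visit = 2, retrieval_visit = 2\<rparr>"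
  let ?vs = "map ?f [0..<n + 4]"
  have trk: "truck_route (shuttle_instance n t) ?vs"
    unfolding truck_route_def
  proof (intro conjI)
    show "hd ?vs = 0" "last ?vs = 0"
      by (simp_all add: hd_map last_map)
    show "set ?vs \<subseteq> truck_nodes (shuttle_instance n t)"
      by auto
    show "distinct_adj ?vs"
      using assms by (auto simp: distinct_adj_conv_nth)
  qed simp
  have fm: "feasible_mission (shuttle_instance n t) ?vs (?g k)" if "k < 2 * n" for k
    using that shuttle_sorties(3)[of k n t] shuttle_sorties(4)[of "k - n" n t]
    by (auto simp: feasible_mission_def simp del: upt_Suc)
  have "solution (shuttle_instance n t) (shuttle_cycle_plan n)"
    unfolding solution_def
  proof (intro conjI)
    show "nodes (shuttle_instance n t) \<subseteq> set (route (shuttle_cycle_plan n)) \<union>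
        (\<Union>xs\<in>set (missions (shuttle_cycle_plan n)). \<Union>x\<in>set xs. served (sortie_of x))"
    proof
      fix u assume "u \<in> nodes (shuttle_instance n t)"
      then have "u \<le> 3 * n + 2"
        by simp
      then show "u \<in> set (route (shuttle_cycle_plan n)) \<union>
          (\<Union>xs\<in>set (missions (shuttle_cycle_plan n)). \<Union>x\<in>set xs. served (sortie_of x))"
      proof (cases rule: shuttle_nodes_cases)
        case 1
        then have "u = ?f u" "u < n + 4"
          by auto
        then have "u \<in> set ?vs"
          by (intro in_map_upt[where i = "u"])
        then show ?thesis
          unfolding shuttle_cycle_plan_def plan.simps by (rule UnI1)
      next
        case (2 q)
        then have "u = ?f (q + 3)" "q + 3 < n + 4"
          by auto
        then have "u \<in> set ?vs"
          by (intro in_map_upt[where i = "q + 3"])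
        then show ?thesis
          unfolding shuttle_cycle_plan_def plan.simps by (rule UnI1)
      next
        case (3 q)
        then have u: "u \<in> served (sortie_of (?g q))" and "q < 2 * n"
          by (auto simp: served_def)
        then have mem: "?g q \<in> set (map ?g [0..<2 * n])"
          by (intro in_map_upt[where i = "q"] refl)
        show ?thesis
          unfolding shuttle_cycle_plan_def plan.simps
          by (rule UnI2, rule UN_I, rule list.set_intros(1), rule UN_I, rule mem, rule u)
      next
        case (4 q)
        then have u: "u \<in> served (sortie_of (?g (n + q)))" and "n + q < 2 * n"
          by (auto simp: served_def)
        then have mem: "?g (n + q) \<in> set (map ?g [0..<2 * n])"
          by (intro in_map_upt[where i = "n + q"] refl)
        show ?thesis
          unfolding shuttle_cycle_plan_def plan.simps
          by (rule UnI2, rule UN_I, rule list.set_intros(1), rule UN_I, rule mem, rule u)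
      qed
    qed
    show "\<forall>xs\<in>set (missions (shuttle_cycle_plan n)). \<forall>x\<in>set xs.
        feasible_mission (shuttle_instance n t) (route (shuttle_cycle_plan n)) x"
    proof -
      have "feasible_mission (shuttle_instance n t) ?vs x" if "x \<in> set (map ?g [0..<2 * n])" for x
        using that fm unfolding set_map set_upt by (elim imageE) (simp only: atLeastLessThan_iff)
      then show ?thesis
        unfolding shuttle_cycle_plan_def plan.simps by (simp only: list.set ball_simps simp_thms) blast
    qed
  qed (use trk in \<open>auto simp: shuttle_cycle_plan_def simp del: upt_Suc\<close>)
  moreover have "distinct (map ?f [0..<n + 3])"
    by (auto simp: distinct_map inj_on_def)
  moreover have "n + 4 = Suc (n + 3)"
    by simp
  then have "butlast ?vs = map ?f [0..<n + 3]"
    by (simp only: butlast_map_upt)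
  ultimately show ?thesis
    by (simp add: cycle_solution_def shuttle_cycle_plan_def)
qed

text \<open>Evaluates the total height of \<open>shuttle_plan\<close>, whose leaves sit at the
  visits congruent to \<open>2\<close> modulo \<open>3\<close>.\<close>

lemma sum_every_third:
  fixes a :: real
  shows "(\<Sum>i<3 * n + 2. if i mod 3 = 2 then a else 0) = real n * a"
proof (induction n)
  case 0
  have "{..<2} = {0, 1::nat}"
    by auto
  then show ?case by simp
next
  case (Suc n)
  define g where "g i = (if i mod 3 = 2 then a else 0)" for i :: nat
  have e: "3 * Suc n + 2 = Suc (Suc (Suc (3 * n + 2)))"
    by simp
  have "g (3 * n + 2) = a" "g (Suc (3 * n + 2)) = 0" "g (Suc (Suc (3 * n + 2))) = 0"
    by (auto simp: g_def mod_Suc)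
  then have "(\<Sum>i<3 * Suc n + 2. g i) = (\<Sum>i<3 * n + 2. g i) + a"
    unfolding e sum.lessThan_Suc by linarith
  with Suc show ?case
    by (simp add: g_def algebra_simps)
qed

section \<open>Optimal values of the shuttle instance\<close>

lemma TSP_mD_shuttle_le:
  assumes "n \<ge> 1" "t \<ge> 1"
  shows "TSP_mD (shuttle_instance n t) \<le> 2 * real n * real t + 3 * real n + 1"
proof -
  interpret integral_instance "shuttle_instance n t"
    by (rule integral_shuttle_instance) fact
  let ?h = "\<lambda>u::nat. if 2 < u \<and> u mod 3 = 0 then real t else 0"
  let ?f = "\<lambda>i. if i = 0 \<or> i = 3 * n + 1 then 0
    else if i mod 3 = 1 then 1 else if i mod 3 = 2 then i + 1 else (2::nat)"
  let ?vs = "map ?f [0..<3 * n + 2]"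
  have S: "solution (shuttle_instance n t) (shuttle_plan n)"
    by (rule solution_shuttle_plan) fact
  have r: "route (shuttle_plan n) = ?vs"
    by (simp add: shuttle_plan_def)
  \<comment> \<open>From hub \<open>1\<close> via a leaf to hub \<open>2\<close> the truck needs
    \<open>2 t + 2\<close>, one unit more than the drone.\<close>
  have fast: "2 * real t + 1 \<le> (\<Sum>i\<in>{3 * q + 1..<3 * q + 3}. star ?h (?vs ! i) (?vs ! Suc i))"
    if "q < n" for q
  proof -
    define vs where "vs = ?vs"
    have vs: "vs ! (3 * q + 1) = 1" "vs ! (3 * q + 2) = 3 * q + 3" "vs ! (3 * q + 3) = 2"
      using that by (auto simp: vs_def mod_Suc simp del: upt_Suc)
    have "{3 * q + 1..<3 * q + 3} = {3 * q + 1, 3 * q + 2}"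
        "Suc (3 * q + 1) = 3 * q + 2" "Suc (3 * q + 2) = 3 * q + 3"
      by auto
    moreover have "(\<Sum>i\<in>{3 * q + 1, 3 * q + 2}. g i) = g (3 * q + 1) + g (3 * q + 2)"
      for g :: "nat \<Rightarrow> real"
      by simp
    ultimately have "(\<Sum>i\<in>{3 * q + 1..<3 * q + 3}. star ?h (vs ! i) (vs ! Suc i)) =
        star ?h 1 (3 * q + 3) + star ?h (3 * q + 3) 2"
      by (simp only: vs)
    also have "\<dots> = 2 * real t + 2"
      by (simp add: star_def)
    finally show ?thesis
      unfolding vs_def[symmetric] by simp
  qed
  have "TSP_mD (shuttle_instance n t) \<le>
      (\<Sum>i<length (route (shuttle_plan n)) - 1. truck_time (shuttle_instance n t)
        (route (shuttle_plan n) ! i) (route (shuttle_plan n) ! Suc i))"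
  proof (rule TSP_mD_le_travel[OF S])
    fix x xs assume "xs \<in> set (missions (shuttle_plan n))" "x \<in> set xs"
    then obtain q where q: "q < n" and x: "x = \<lparr>sortie_of = [1, 3 * q + 4, 3 * q + 5, 2],
        launch_visit = 3 * q + 1, retrieval_visit = 3 * q + 3\<rparr>"
      by (auto simp: shuttle_plan_def)
    show "duration (shuttle_instance n t) (sortie_of x) \<le>
      (\<Sum>i\<in>{launch_visit x..<retrieval_visit x}. truck_time (shuttle_instance n t)
        (route (shuttle_plan n) ! i) (route (shuttle_plan n) ! Suc i))"
      using fast[OF q] unfolding x r
      by (simp only: shuttle_sorties(2)[OF q] mission.simps shuttle_instance_simps)
  qed
  \<comment> \<open>The route has \<open>3 n + 1\<close> arcs and starts and ends at height
    \<open>0\<close>.\<close>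
  also have "\<dots> = 2 * (\<Sum>v\<leftarrow>?vs. ?h v) + 3 * real n + 1"
    using S star_travel[of ?vs ?h] unfolding solution_def truck_route_def r shuttle_instance_simps
    by (simp del: upt_Suc)
  also have "(\<Sum>v\<leftarrow>?vs. ?h v) = (\<Sum>i<3 * n + 2. if i mod 3 = 2 then real t else 0)"
    unfolding map_map comp_def interv_sum_list_conv_sum_set_nat set_upt lessThan_atLeast0
    by (rule sum.cong) (auto simp: mod_Suc)
  also have "\<dots> = real n * real t"
    by (rule sum_every_third)
  finally show ?thesis by simp
qed

text \<open>Each of the \<open>n\<close> leaves must be visited by the truck and costs
  \<open>2 t\<close> of driving.\<close>

lemma dep_last_shuttle_ge:
  assumes "t \<ge> 1" and S: "solution (shuttle_instance n t) S"
    and sch: "schedule (shuttle_instance n t) S arr dep lau ret"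
    and V: "V \<subseteq> {..<length (route S)}" and wait: "W \<le> (\<Sum>v\<in>V. dep v - arr v)"
  shows "W + 2 * real n * real t \<le> dep (length (route S) - 1)"
proof -
  interpret integral_instance "shuttle_instance n t"
    by (rule integral_shuttle_instance) fact
  let ?h = "\<lambda>u::nat. if 2 < u \<and> u mod 3 = 0 then real t else 0"
  let ?U = "nodes (shuttle_instance n t) - drone_nodes (shuttle_instance n t)"
  have "W + 2 * (\<Sum>v\<in>?U. ?h v) \<le> dep (length (route S) - 1)"
    by (intro dep_last_ge[OF S sch V wait]) auto
  moreover have "real n * real t \<le> (\<Sum>v\<in>?U. ?h v)"
  proof -
    have "(\<Sum>i<n. real t) = (\<Sum>i<n. ?h (3 * Suc i))"
      by simp
    also have "\<dots> = (\<Sum>v\<in>(\<lambda>i. 3 * Suc i) ` {..<n}. ?h v)"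
      by (subst sum.reindex) (auto simp: inj_on_def)
    also have "\<dots> \<le> (\<Sum>v\<in>?U. ?h v)"
      by (intro sum_mono2) auto
    finally show ?thesis by simp
  qed
  ultimately show ?thesis by linarith
qed

lemma TSP_mD_shuttle_pos:
  assumes "n \<ge> 1" "t \<ge> 1"
  shows "0 < TSP_mD (shuttle_instance n t)"
proof -
  interpret integral_instance "shuttle_instance n t"
    by (rule integral_shuttle_instance) fact
  have "2 * real n * real t \<le> TSP_mD (shuttle_instance n t)"
    unfolding TSP_mD_def
  proof (rule optimum_ge)
    show "solution (shuttle_instance n t) (shuttle_plan n)"
      by (rule solution_shuttle_plan) fact
    show "2 * real n * real t \<le> dep (length (route S) - 1)"
      if "solution (shuttle_instance n t) S" "schedule (shuttle_instance n t) S arr dep lau ret"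
      for S arr dep lau ret
      using dep_last_shuttle_ge[OF assms(2) that, of "{}" 0] by simp
  qed
  then show ?thesis
    using assms by (smt (verit) mult_pos_pos of_nat_0_less_iff One_nat_def Suc_le_eq)
qed

text \<open>The missions in \<open>L\<close>, which end at the visit of their launch, serve one
  customer each and cost \<open>2 t\<close> of waiting each. At most one mission lies outside
  \<open>L\<close>, and it serves at most two customers, so \<open>L\<close> has at least
  \<open>2 n - 2\<close> elements; driving adds \<open>2 n t\<close>.\<close>

lemma m_CYCLE_shuttle_ge:
  assumes "n \<ge> 1" "t \<ge> 1"
  shows "2 * real t * (3 * real n - 2) \<le> m_CYCLE (shuttle_instance n t)"
proof -
  interpret integral_instance "shuttle_instance n t"
    by (rule integral_shuttle_instance) fact
  show ?thesis
    unfolding m_CYCLE_def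
  proof (rule optimum_ge)
    show "solution (shuttle_instance n t) S" if "cycle_solution (shuttle_instance n t) S" for S
      using that by (simp add: cycle_solution_def)
    show "cycle_solution (shuttle_instance n t) (shuttle_cycle_plan n)"
      by (rule cycle_solution_shuttle_cycle_plan) fact
  next
    fix S arr dep lau ret
    assume cyc: "cycle_solution (shuttle_instance n t) S"
      and sch: "schedule (shuttle_instance n t) S arr dep lau ret"
    have S: "solution (shuttle_instance n t) S"
      using cyc by (simp add: cycle_solution_def)
    have len: "length (missions S) = 1"
      using S by (simp add: solution_def)
    define xs where "xs = missions S ! 0"
    let ?K = "{..<length xs}"
    have fm: "feasible_mission (shuttle_instance n t) (route S) (xs ! k)" if "k \<in> ?K" for k
      using S len that unfolding solution_def xs_def by (metis lessThan_iff nth_mem zero_less_one)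
    define L where "L = {k \<in> ?K. launch_visit (xs ! k) = retrieval_visit (xs ! k)}"
    have visits: "launch_visit (xs ! k) < length (route S)" "retrieval_visit (xs ! k) < length (route S)"
        "launch_visit (xs ! k) \<le> retrieval_visit (xs ! k)"
        "route S ! launch_visit (xs ! k) \<in> {1, 2}" "route S ! retrieval_visit (xs ! k) \<in> {1, 2}"
      if "k \<in> ?K" for k
      using fm[OF that] shuttle_sortie(1,2)[OF assms(2), of n "sortie_of (xs ! k)"]
      by (auto simp: feasible_mission_def)
    have order: "retrieval_visit (xs ! k) \<le> launch_visit (xs ! k')" if "k < k'" "k' \<in> ?K" for k k'
      using that
    proof (induction k')
      case (Suc k')
      have "retrieval_visit (xs ! k') \<le> launch_visit (xs ! Suc k')"
        using Suc.prems len unfolding xs_def by (intro mission_order[OF S]) auto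
      moreover have "launch_visit (xs ! k') \<le> retrieval_visit (xs ! k')"
        using Suc.prems by (intro visits) auto
      ultimately show ?case
        using Suc by (cases "k = k'") auto
    qed simp
    \<comment> \<open>Pigeonhole: two missions outside \<open>L\<close> would yield three different
      visits at only two hubs, while a cycle visits each hub at most once.\<close>
    have open1: "k = k'" if "k \<in> ?K - L" "k' \<in> ?K - L" for k k'
    proof -
      have False if kk: "k < k'" "k \<in> ?K - L" "k' \<in> ?K - L" for k k'
      proof -
        let ?a = "launch_visit (xs ! k)" and ?b = "retrieval_visit (xs ! k)"
          and ?c = "retrieval_visit (xs ! k')"
        have K: "k \<in> ?K" "k' \<in> ?K"
          using kk by auto
        have lt: "?a < ?b" "?b < ?c"
          using kk order[OF kk(1) K(2)] visits(3)[OF K(1)] visits(3)[OF K(2)] by (auto simp: L_def)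
        have "route S ! ?a = route S ! ?b \<or> route S ! ?b = route S ! ?c \<or> route S ! ?a = route S ! ?c"
          using visits(4,5)[OF K(1)] visits(5)[OF K(2)] by auto
        moreover have "route S ! ?a \<noteq> 0" "route S ! ?b \<noteq> 0"
          using visits(4,5)[OF K(1)] by auto
        ultimately have "?a = ?b \<or> ?b = ?c \<or> ?a = ?c"
          using cycle_visit_unique[OF cyc] visits(1,2)[OF K(1)] visits(2)[OF K(2)] by blast
        then show False
          using lt by linarith
      qed
      then show ?thesis
        using that by (metis linorder_neqE_nat)
    qed
    have card_open: "card (?K - L) \<le> 1"
      using open1 by (subst card_le_Suc0_iff_eq[unfolded One_nat_def[symmetric]]) auto
    let ?C = "nodes (shuttle_instance n t) - truck_nodes (shuttle_instance n t)"
    have card_C: "2 * n \<le> card ?C"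
    proof -
      let ?A = "(\<lambda>q. 3 * q + 4) ` {..<n}" and ?B = "(\<lambda>q. 3 * q + 5) ` {..<n}"
      have "card ?A = n" "card ?B = n"
        by (simp_all add: card_image inj_on_def)
      moreover have "?A \<inter> ?B = {}"
        by auto presburger
      ultimately have "card (?A \<union> ?B) = 2 * n"
        by (simp add: card_Un_disjoint)
      moreover have "?A \<union> ?B \<subseteq> ?C"
        by auto presburger+
      then have "card (?A \<union> ?B) \<le> card ?C"
        by (intro card_mono) auto
      ultimately show ?thesis
        by simp
    qed
    have "?C \<subseteq> (\<Union>k\<in>?K. served (sortie_of (xs ! k)))"
    proof
      fix c assume "c \<in> ?C"
      then show "c \<in> (\<Union>k\<in>?K. served (sortie_of (xs ! k)))"
        by (rule drone_only_served[OF S]) (use len in \<open>auto simp: xs_def\<close>)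
    qed
    then have "card ?C \<le> card (\<Union>k\<in>?K. served (sortie_of (xs ! k)))"
      by (intro card_mono) (auto simp: served_def)
    also have "\<dots> \<le> (\<Sum>k\<in>?K. card (served (sortie_of (xs ! k))))"
      by (rule card_UN_le) simp
    also have "\<dots> = (\<Sum>k\<in>L. card (served (sortie_of (xs ! k)))) +
        (\<Sum>k\<in>?K - L. card (served (sortie_of (xs ! k))))"
      by (subst add.commute, rule sum.subset_diff) (auto simp: L_def)
    \<comment> \<open>A mission in \<open>L\<close> is a loop, as its two ends are the node of the
      same visit.\<close>
    also have "\<dots> \<le> (\<Sum>k\<in>L. 1) + (\<Sum>k\<in>?K - L. 2)"
    proof (intro add_mono sum_mono)
      show "card (served (sortie_of (xs ! k))) \<le> 2" if "k \<in> ?K - L" for k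
        using that fm shuttle_sortie(4)[OF assms(2)] by (auto simp: feasible_mission_def)
      show "card (served (sortie_of (xs ! k))) \<le> 1" if "k \<in> L" for k
      proof (rule shuttle_sortie(5)[OF assms(2)])
        show "feasible_sortie (shuttle_instance n t) (sortie_of (xs ! k))"
            "is_loop (sortie_of (xs ! k))"
          using fm[of k] that by (auto simp: L_def feasible_mission_def is_loop_def)
      qed
    qed
    also have "\<dots> \<le> card L + 2"
      using card_open by simp
    finally have cardL: "2 * real n - 2 \<le> real (card L)"
      using card_C by linarith
    let ?V = "(\<lambda>k. launch_visit (xs ! k)) ` L"
    have "2 * real t * real (card L) + 2 * real n * real t \<le> dep (length (route S) - 1)"
    proof (rule dep_last_shuttle_ge[OF assms(2) S sch])
      show "?V \<subseteq> {..<length (route S)}"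
        using visits(1) unfolding L_def by blast
      have "2 * real t * real (card L) \<le> (\<Sum>k\<in>L. duration (shuttle_instance n t) (sortie_of (xs ! k)))"
        using sum_bounded_below[of L "2 * real t"] shuttle_sortie(3)[OF assms(2)] fm
        by (auto simp: L_def feasible_mission_def mult.commute)
      \<comment> \<open>Many loops may share a visit; grouped by visit, those of one group are flown
        in sequence during a single stay.\<close>
      also have "\<dots> = (\<Sum>v\<in>?V. \<Sum>k\<in>{k \<in> L. launch_visit (xs ! k) = v}.
          duration (shuttle_instance n t) (sortie_of (xs ! k)))"
        by (rule sum.group[symmetric]) (auto simp: L_def)
      also have "\<dots> \<le> (\<Sum>v\<in>?V. dep v - arr v)"
      proof (rule sum_mono)
        fix v assume "v \<in> ?V"
        then have v: "v < length (route S)"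
          using visits(1) unfolding L_def by blast
        show "(\<Sum>k\<in>{k \<in> L. launch_visit (xs ! k) = v}.
            duration (shuttle_instance n t) (sortie_of (xs ! k))) \<le> dep v - arr v"
          unfolding xs_def using v len
          by (intro loop_durations_le_wait[OF sch]) (auto simp: L_def xs_def)
      qed
      finally show "2 * real t * real (card L) \<le> (\<Sum>v\<in>?V. dep v - arr v)" .
    qed
    moreover have "2 * real t * (2 * real n - 2) \<le> 2 * real t * real (card L)"
      using cardL by (intro mult_left_mono) auto
    ultimately show "2 * real t * (3 * real n - 2) \<le> dep (length (route S) - 1)"
      by (simp add: algebra_simps)
  qed
qed

text \<open>With \<open>t = n\<close>, numerator and denominator grow like \<open>6 n^2\<close> and
  \<open>2 n^2\<close>, so the linear overhead vanishes in the limit.\<close>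

lemma shuttle_ratio:
  assumes "n \<ge> 1"
  shows "3 - 7 / real n \<le> m_CYCLE (shuttle_instance n n) / TSP_mD (shuttle_instance n n)"
proof -
  have "3 - 7 / real n \<le> 2 * real n * (3 * real n - 2) / (2 * real n * real n + 3 * real n + 1)"
  proof -
    have pos: "0 < 2 * real n * real n + 3 * real n + 1" "0 < real n"
      using assms by (auto intro!: add_nonneg_pos)
    \<comment> \<open>The constant \<open>7\<close> makes the linear coefficient
      \<open>9 - 2 * 7 = -5\<close>, below the \<open>-4\<close> of
      \<open>2 n (3 n - 2)\<close>.\<close>
    have "(3 - 7 / real n) * (2 * real n * real n + 3 * real n + 1) =
        2 * real n * (3 * real n - 2) - real n - 18 - 7 / real n"
      using pos(2) by (simp add: field_simps)
    also have "\<dots> \<le> 2 * real n * (3 * real n - 2)"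
      using divide_nonneg_pos[of 7 "real n"] pos(2) by linarith
    finally show ?thesis
      using pos(1) by (simp add: pos_le_divide_eq)
  qed
  also have "\<dots> \<le> m_CYCLE (shuttle_instance n n) / TSP_mD (shuttle_instance n n)"
  proof (rule frac_le)
    show "2 * real n * (3 * real n - 2) \<le> m_CYCLE (shuttle_instance n n)"
      by (rule m_CYCLE_shuttle_ge) fact+
    moreover have "0 \<le> 2 * real n * (3 * real n - 2)"
      using assms by simp
    ultimately show "0 \<le> m_CYCLE (shuttle_instance n n)"
      by linarith
  qed (use TSP_mD_shuttle_le[OF assms assms] TSP_mD_shuttle_pos[OF assms assms] in auto)
  finally show ?thesis .
qed


subsection \<open>The lower bounds\<close>

theorem proposition5p3:
  shows "(\<forall>\<delta>::real. \<delta> > 0 \<longrightarrow>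
           (\<exists>I. tsp_mD_instance I \<and> (\<exists>S. solution I S) \<and> num_drones I = 1 \<and>
                m_CYCLE I / TSP_mD I \<ge> 3 - \<delta>)) \<and>
         (\<forall>\<delta>::real. \<delta> > 0 \<longrightarrow>
           (\<exists>I. tsp_mD_instance I \<and> (\<exists>S. solution I S) \<and> num_drones I = 1 \<and>
                loops_or_single_customer I \<and>
                m_CYCLE I / TSP_mD I \<ge> 2 - \<delta>)) \<and>
         (\<forall>m::nat. m \<ge> 1 \<longrightarrow>
           (\<exists>I. tsp_mD_instance I \<and> (\<exists>S. solution I S) \<and> num_drones I = m \<and>
                m_CYCLE I / TSP_mD I \<ge> real m))"
proof (intro conjI allI impI)
  fix \<delta> :: real assume "\<delta> > 0"
  define n where "n = nat \<lceil>7 / \<delta>\<rceil>"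
  have "0 < 7 / \<delta>"
    using \<open>\<delta> > 0\<close> by simp
  then have n: "n \<ge> 1" "7 / \<delta> \<le> real n"
    unfolding n_def by linarith+
  then have "7 / real n \<le> \<delta>"
    using \<open>\<delta> > 0\<close> by (simp add: field_simps)
  then have "m_CYCLE (shuttle_instance n n) / TSP_mD (shuttle_instance n n) \<ge> 3 - \<delta>"
    using shuttle_ratio[OF n(1)] by linarith
  then show "\<exists>I. tsp_mD_instance I \<and> (\<exists>S. solution I S) \<and> num_drones I = 1 \<and>
      m_CYCLE I / TSP_mD I \<ge> 3 - \<delta>"
    using integral_instance.inst[OF integral_shuttle_instance[OF n(1)]] solution_shuttle_plan[OF n(1)]
      shuttle_instance_simps(6) by blast
next
  fix \<delta> :: real assume "\<delta> > 0"
  define t where "t = nat \<lceil>4 / \<delta>\<rceil>"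
  have "0 < 4 / \<delta>"
    using \<open>\<delta> > 0\<close> by simp
  then have t: "t \<ge> 1" "4 / \<delta> \<le> real t"
    unfolding t_def by linarith+
  \<comment> \<open>For \<open>m = 1\<close> the bound of \<open>star_ratio\<close> is
    \<open>2 t / (t + 2) = 2 - 4 / (t + 2)\<close>.\<close>
  have "4 \<le> \<delta> * (real t + 2)"
    using t(2) \<open>\<delta> > 0\<close> by (simp add: field_simps)
  then have "2 - \<delta> \<le> real t * (real 1 + 1) / (real t + real 1 + 1)"
    by (simp add: field_simps)
  then have "m_CYCLE (star_instance 1 t) / TSP_mD (star_instance 1 t) \<ge> 2 - \<delta>"
    using star_ratio[of 1 t] t(1) by simp
  then show "\<exists>I. tsp_mD_instance I \<and> (\<exists>S. solution I S) \<and> num_drones I = 1 \<and>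
      loops_or_single_customer I \<and> m_CYCLE I / TSP_mD I \<ge> 2 - \<delta>"
    using integral_instance.inst[OF integral_star_instance[of 1, OF order_refl t(1)]]
      solution_star_plan[of 1, OF order_refl] star_instance_simps(6)
      loops_or_single_customer_star_instance[of 1, OF order_refl t(1)] by blast
next
  fix m :: nat assume m: "m \<ge> 1"
  \<comment> \<open>With this choice \<open>t + m + 1 = (m + 1)^2\<close>, and the bound of
    \<open>star_ratio\<close> is exactly \<open>m\<close>.\<close>
  define t where "t = m * (m + 1)"
  have t: "t \<ge> 1"
    using m by (simp add: t_def)
  have "real m = real t * (real m + 1) / (real t + real m + 1)"
    using m by (simp add: t_def field_simps add_nonneg_eq_0_iff)
  then have "m_CYCLE (star_instance m t) / TSP_mD (star_instance m t) \<ge> real m"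
    using star_ratio[OF m t] by simp
  then show "\<exists>I. tsp_mD_instance I \<and> (\<exists>S. solution I S) \<and> num_drones I = m \<and>
      m_CYCLE I / TSP_mD I \<ge> real m"
    using integral_instance.inst[OF integral_star_instance[OF m t]] solution_star_plan[OF m]
      star_instance_simps(6) by blast
qed

end
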